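(* Let $F\subset \mathrm{Sym}^2(\mathbb{R}^n)$ be a cone subequation, let $\Omega\subset\mathbb{R}^n$ be a bounded domain, let $x_1,\dots,x_k\in\Omega$ be distinct points, let $\varphi\in C(\partial\Omega)$, and for each $j=1,\dots,k$ let $h_j$ be a downward-pointing singular $F$-harmonic at $x_j$ (each of polar or of finite type). Then there is at most one function $H$ which is a solution of the Dirichlet problem with prescribed singularities (DPPS) for the data $\varphi$, $(x_j,h_j)_{j=1}^k$.
   Context: $\mathrm{Sym}^2(\mathbb{R}^n)$ is the space of real symmetric $n\times n$ matrices; $P\ge 0$ means positive semidefinite. A cone subequation is a closed set $F\subset\mathrm{Sym}^2(\mathbb{R}^n)$ such that $A\in F,\ P\ge0\Rightarrow A+P\in F$, and $tF=F$ for all $t>0$. Its dual is $\tilde F=\{A: -A\notin \mathrm{Int}\,F\}$. On an open set $X$, an upper semicontinuous $u:X\to[-\infty,\infty)$ is $F$-subharmonic if for every $x_0\in X$ and every $C^2$ function $\phi$ near $x_0$ with $u\le\phi$ near $x_0$ and $u(x_0)=\phi(x_0)$ (a test function for $u$ at $x_0$), one has $D^2\phi(x_0)\in F$. A function $u$ is $F$-harmonic on $X$ if $u$ is finite and continuous, $u$ is $F$-subharmonic and $-u$ is $\tilde F$-subharmonic on $X$. A downward-pointing singular $F$-harmonic at $x_0$ is a continuous $[-\infty,\infty)$-valued $F$-subharmonic function $h$ on a neighborhood $U$ of $x_0$, $F$-harmonic on $U\setminus\{x_0\}$, with $h(x)>h(x_0)$ for $x\in U\setminus\{x_0\}$, and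 either (polar type) $h(x_0)=-\infty$, or (finite type) $h(x_0)>-\infty$ and $h$ has no test functions at $x_0$. A solution of the (DPPS) is a function $H$, defined on $\overline\Omega$ minus the points $x_j$ with $h_j$ of polar type and real-valued there, such that: (1) $H\in C(\overline\Omega\setminus\{x_1,\dots,x_k\})$; (2) $H$ is $F$-harmonic on $\Omega\setminus\{x_1,\dots,x_k\}$; (3) $H|_{\partial\Omega}=\varphi$; (4) $H$ is asymptotically equivalent to $h_j$ at each $x_j$, meaning: if $h_j$ is of polar type, there is a constant $C>0$ with $h_j-C\le H\le h_j+C$ near $x_j$; if $h_j$ is of finite type, $\lim_{x\to x_j}\frac{H(x)-H(x_j)}{h_j(x)-h_j(x_j)}=1$. *)

theory Defs
  imports "HOL-Analysis.Analysis"
begin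

definition Sym2 :: "(real^'n^'n) set" where
  "Sym2 = {A. transpose A = A}"

definition psd :: "real^'n^'n \<Rightarrow> bool" where
  "psd P \<longleftrightarrow> P \<in> Sym2 \<and> (\<forall>x. 0 \<le> x \<bullet> (P *v x))"

text \<open>A cone subequation: a closed subset of Sym2 (closedness in Sym2 is the same as
  closedness in the ambient matrix space, since Sym2 is closed), with the positivity
  and cone properties.\<close>
definition cone_subequation :: "(real^'n^'n) set \<Rightarrow> bool" where
  "cone_subequation F \<longleftrightarrow>
     F \<subseteq> Sym2 \<and> closed F \<and>
     (\<forall>A P. A \<in> F \<and> psd P \<longrightarrow> A + P \<in> F) \<and>
     (\<forall>t>0. (\<lambda>A. t *\<^sub>R A) ` F = F)"

definition sym_interior :: "(real^'n^'n) set \<Rightarrow> (real^'n^'n) set" where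
  "sym_interior F = {A \<in> F. \<exists>e>0. \<forall>B\<in>Sym2. dist B A < e \<longrightarrow> B \<in> F}"

definition dual_subeq :: "(real^'n^'n) set \<Rightarrow> (real^'n^'n) set" where
  "dual_subeq F = {A \<in> Sym2. - A \<notin> sym_interior F}"

definition C2_hessian :: "(real^'n \<Rightarrow> real) \<Rightarrow> real^'n \<Rightarrow> real^'n^'n \<Rightarrow> bool" where
  "C2_hessian \<phi> x0 A \<longleftrightarrow>
     (\<exists>e>0. \<exists>g Hs.
        (\<forall>y\<in>ball x0 e. (\<phi> has_derivative (\<lambda>h. g y \<bullet> h)) (at y)) \<and>
        (\<forall>y\<in>ball x0 e. (g has_derivative (\<lambda>h. Hs y *v h)) (at y)) \<and>
        continuous_on (ball x0 e) Hs \<and> Hs x0 = A)"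

definition touches_above :: "(real^'n \<Rightarrow> ereal) \<Rightarrow> real^'n \<Rightarrow> (real^'n \<Rightarrow> real) \<Rightarrow> bool" where
  "touches_above u x0 \<phi> \<longleftrightarrow>
     (\<forall>\<^sub>F y in nhds x0. u y \<le> ereal (\<phi> y)) \<and> u x0 = ereal (\<phi> x0)"

definition test_fn :: "(real^'n \<Rightarrow> ereal) \<Rightarrow> real^'n \<Rightarrow> (real^'n \<Rightarrow> real) \<Rightarrow> real^'n^'n \<Rightarrow> bool" where
  "test_fn u x0 \<phi> A \<longleftrightarrow> C2_hessian \<phi> x0 A \<and> touches_above u x0 \<phi>"

definition usc_on :: "(real^'n) set \<Rightarrow> (real^'n \<Rightarrow> ereal) \<Rightarrow> bool" where
  "usc_on X u \<longleftrightarrow> (\<forall>x\<in>X. \<forall>c. u x < c \<longrightarrow> (\<forall>\<^sub>F y in at x within X. u y < c))"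

definition F_subharmonic :: "(real^'n^'n) set \<Rightarrow> (real^'n) set \<Rightarrow> (real^'n \<Rightarrow> ereal) \<Rightarrow> bool" where
  "F_subharmonic F X u \<longleftrightarrow>
     usc_on X u \<and> (\<forall>x\<in>X. u x \<noteq> \<infinity>) \<and>
     (\<forall>x0\<in>X. \<forall>\<phi> A. test_fn u x0 \<phi> A \<longrightarrow> A \<in> F)"

definition F_harmonic :: "(real^'n^'n) set \<Rightarrow> (real^'n) set \<Rightarrow> (real^'n \<Rightarrow> ereal) \<Rightarrow> bool" where
  "F_harmonic F X u \<longleftrightarrow>
     (\<forall>x\<in>X. \<bar>u x\<bar> \<noteq> \<infinity>) \<and> continuous_on X u \<and>
     F_subharmonic F X u \<and> F_subharmonic (dual_subeq F) X (\<lambda>x. - u x)"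

definition singular_harmonic_at :: "(real^'n^'n) set \<Rightarrow> real^'n \<Rightarrow> (real^'n \<Rightarrow> ereal) \<Rightarrow> bool" where
  "singular_harmonic_at F x0 h \<longleftrightarrow>
     (\<exists>U. open U \<and> x0 \<in> U \<and>
        continuous_on U h \<and> (\<forall>x\<in>U. h x \<noteq> \<infinity>) \<and>
        F_subharmonic F U h \<and> F_harmonic F (U - {x0}) h \<and>
        (\<forall>x\<in>U - {x0}. h x > h x0) \<and>
        (h x0 = -\<infinity> \<or> (h x0 \<noteq> -\<infinity> \<and> \<not> (\<exists>\<phi> A. test_fn h x0 \<phi> A))))"

definition polar_type :: "real^'n \<Rightarrow> (real^'n \<Rightarrow> ereal) \<Rightarrow> bool" where
  "polar_type x0 h \<longleftrightarrow> h x0 = -\<infinity>"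

text \<open>The domain of a solution: closure of Omega minus the polar-type points.
  Solutions are represented as total real functions; only values on this domain matter.\<close>
definition DPPS_domain :: "(real^'n) set \<Rightarrow> nat \<Rightarrow> (nat \<Rightarrow> real^'n) \<Rightarrow> (nat \<Rightarrow> real^'n \<Rightarrow> ereal) \<Rightarrow> (real^'n) set" where
  "DPPS_domain \<Omega> k xs hs = closure \<Omega> - {xs j | j. j < k \<and> polar_type (xs j) (hs j)}"

definition asymp_equiv_at :: "real^'n \<Rightarrow> (real^'n \<Rightarrow> ereal) \<Rightarrow> (real^'n \<Rightarrow> real) \<Rightarrow> bool" where
  "asymp_equiv_at x0 h H \<longleftrightarrow>
     (if polar_type x0 h then
        (\<exists>C>0. \<forall>\<^sub>F x in at x0. h x - ereal C \<le> ereal (H x) \<and> ereal (H x) \<le> h x + ereal C)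
      else
        ((\<lambda>x. (H x - H x0) / (real_of_ereal (h x) - real_of_ereal (h x0))) \<longlongrightarrow> 1) (at x0))"

definition DPPS_solution ::
  "(real^'n^'n) set \<Rightarrow> (real^'n) set \<Rightarrow> (real^'n \<Rightarrow> real) \<Rightarrow> nat \<Rightarrow> (nat \<Rightarrow> real^'n)
     \<Rightarrow> (nat \<Rightarrow> real^'n \<Rightarrow> ereal) \<Rightarrow> (real^'n \<Rightarrow> real) \<Rightarrow> bool" where
  "DPPS_solution F \<Omega> \<phi> k xs hs H \<longleftrightarrow>
     continuous_on (closure \<Omega> - xs ` {..<k}) H \<and>
     F_harmonic F (\<Omega> - xs ` {..<k}) (\<lambda>x. ereal (H x)) \<and>
     (\<forall>x\<in>frontier \<Omega>. H x = \<phi> x) \<and>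
     (\<forall>j<k. asymp_equiv_at (xs j) (hs j) H)"

end

theory Submission
  imports Defs
begin

text \<open>
  Replace \<open>H1\<close> by \<open>(1 + \<epsilon>) * H1\<close>, which is still subharmonic because \<open>F\<close> is a cone. The difference
  \<open>w = (1 + \<epsilon>) * H1 - H2\<close> then behaves like \<open>\<epsilon> * h\<close> at the singular points: it tends to \<open>-\<infinity>\<close> at
  those of polar type and has strict local minima at those of finite type, so neither can carry its
  maximum over the closure of the domain. Away from them the comparison principle forces the maximum
  to the boundary, where \<open>w = \<epsilon> * \<phi>\<close>; now let \<open>\<epsilon>\<close> tend to \<open>0\<close>.

  For the comparison principle, suppose that \<open>u\<close> and \<open>v\<close> are subharmonic for \<open>F\<close> and its dual and that
  \<open>u + v\<close>, increased by a small multiple of the squared norm, has an interior maximum. Sup-convolutions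
  of \<open>u\<close> and \<open>v\<close> are semiconvex; on the set where their sum is touched from above by affine functions,
  which has positive measure (Jensen), both are almost everywhere twice differentiable (Alexandrov).
  This gives quadratics touching \<open>u\<close> and \<open>v\<close> from above whose Hessians have a negative definite sum,
  which contradicts the definition of the dual.
\<close>

subsection \<open>Rademacher's theorem\<close>

text \<open>Asymptotic equivalence leaves the sign of \<open>H1 - H2\<close> open at a finite-type
  point: both increments are asymptotic to that of \<open>h\<close>, so their difference is of lower
  order. The surplus \<epsilon> supplies a leading term of known sign there, and at polar points a
  term that beats the bounded error.

  \<open>F\<close> is not assumed convex, so averaging a subharmonic function need not preserve
  subharmonicity, and test functions for \<open>u\<close> and \<open>v\<close> need not exist at a
  common point. Sup-convolution is the regularization that survives: a quadratic above the
  regularized function at \<open>x\<close> is carried, by translation, to one above the original at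
  the point where the supremum is attained. The two carried points usually differ, which is harmless
  because \<open>F\<close> constrains Hessians alone, in the same way at every point.

  Convexity of functions enters only through subgradients. At a contact point the two convexified
  functions are bounded above by quadratics, and this makes the derivative of the proximal map
  invertible; Alexandrov's theorem is therefore needed, and proved, only at such points.\<close>

text \<open>
  Adding a steep linear function makes \<open>f\<close> a bi-Lipschitz homeomorphism \<open>G\<close>; the integrand is the
  Radon-Nikodym density of the image of Lebesgue measure under the inverse of \<open>G\<close>.
\<close>
lemma lipschitz_real_increment_has_integral:
  fixes f :: "real \<Rightarrow> real"
  assumes lip: "\<And>x y. \<bar>f x - f y\<bar> \<le> L * \<bar>x - y\<bar>"
  obtains r where "\<And>a b. a \<le> b \<Longrightarrow> (r has_integral f b - f a) {a..b}"
proof -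
  have L0: "L \<ge> 0" using lip[of 1 0] by simp
  \<comment> \<open>Increments of \<open>f\<close> are at least \<open>- L\<close> times the step,
    so those of \<open>G\<close> lie between the step and \<open>2 * L + 1\<close> times it. The
    lower bound makes \<open>G\<close> strictly increasing and onto, the upper one makes it preserve
    null sets.\<close>
  define G where "G x = f x + (L + 1) * x" for x
  have G_diff: "y - x \<le> G y - G x \<and> G y - G x \<le> (2 * L + 1) * (y - x)" if "x \<le> y" for x y
  proof -
    have "\<bar>f y - f x\<bar> \<le> L * (y - x)" using lip[of y x] that by simp
    then show ?thesis unfolding G_def by (auto simp: algebra_simps abs_le_iff)
  qed
  have smG: "strict_mono G"
    by (rule strict_monoI) (use G_diff in \<open>smt (verit)\<close>)
  have abs_G: "\<bar>G y - G x\<bar> \<le> (2 * L + 1) * \<bar>y - x\<bar>" for x y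
    using G_diff[of x y] G_diff[of y x] by (cases "x \<le> y") auto
  have lipG: "(2 * L + 1)-lipschitz_on UNIV G"
    by (rule lipschitz_onI) (use abs_G L0 in \<open>auto simp: dist_real_def\<close>)
  have contG: "continuous_on A G" for A
    using lipschitz_on_continuous_on[OF lipG] continuous_on_subset by blast
  have injG: "inj G" using smG strict_mono_imp_inj_on by blast
  have surjG: "surj G"
  proof (unfold surj_def, intro allI)
    fix y
    let ?c = "\<bar>y - G 0\<bar>"
    have "G (- ?c) \<le> y" using G_diff[of "- ?c" 0] by auto
    moreover have "y \<le> G ?c" using G_diff[of 0 ?c] by auto
    ultimately show "\<exists>x. y = G x"
      using IVT'[of G "- ?c" y ?c] contG by fastforce
  qed
  define K where "K = inv G"
  have GK: "G (K y) = y" for y unfolding K_def by (simp add: surjG surj_f_inv_f)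
  have KG: "K (G x) = x" for x unfolding K_def by (simp add: injG)
  have monoK: "mono K"
    by (rule monoI) (metis GK smG strict_mono_less_eq)
  have mK: "K \<in> borel_measurable borel" using monoK by (rule borel_measurable_mono)
  define N where "N = distr lborel borel K"
  \<comment> \<open>Hence \<open>N\<close> gives a Borel set the length of its image under
    \<open>G\<close>.\<close>
  have vim: "K -` A = G ` A" for A
    using GK KG by (auto simp: image_iff) metis
  have "absolutely_continuous lborel N"
  proof (unfold absolutely_continuous_def, rule subsetI)
    fix A :: "real set" assume A: "A \<in> null_sets lborel"
    then have Ab: "A \<in> sets borel" by auto
    have "negligible A" using A
      by (metis negligible_iff_null_sets null_sets_completionI)
    then have "negligible (G ` A)"
    proof (rule negligible_locally_Lipschitz_image[rotated])
      show "\<exists>T B. open T \<and> x \<in> T \<and> (\<forall>y\<in>A \<inter> T. norm (G y - G x) \<le> B * norm (y - x))" for x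
        using abs_G by (intro exI[of _ UNIV] exI[of _ "2 * L + 1"]) auto
    qed simp
    moreover have "G ` A \<in> sets borel"
      using measurable_sets[OF mK Ab] vim by simp
    ultimately have "emeasure lborel (G ` A) = 0"
      by (simp add: negligible_iff_emeasure0 )
    then show "A \<in> null_sets N"
      unfolding N_def using Ab mK by (auto simp: null_sets_def emeasure_distr vim)
  qed
  moreover have "sets N = sets lborel" by (simp add: N_def)
  ultimately obtain d where d: "d \<in> borel_measurable lborel" "density lborel d = N"
    using sigma_finite_measure.Radon_Nikodym[OF sigma_finite_lborel] by blast
  have nn: "(\<integral>\<^sup>+x. d x * indicator {a..b} x \<partial>lborel) = ennreal (G b - G a)" if "a \<le> b" for a b
  proof -
    have "(\<integral>\<^sup>+x. d x * indicator {a..b} x \<partial>lborel) = emeasure N {a..b}"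
      unfolding d(2)[symmetric] using d(1) by (subst emeasure_density) auto
    also have "\<dots> = emeasure lborel (G ` {a..b})"
      unfolding N_def using mK by (subst emeasure_distr) (auto simp: vim)
    also have "G ` {a..b} = {G a..G b}"
    proof (intro equalityI subsetI)
      fix y assume y: "y \<in> {G a..G b}"
      have "a \<le> K y" "K y \<le> b"
        using y GK[of y] strict_mono_less_eq[OF smG] by (metis atLeastAtMost_iff)+
      then show "y \<in> G ` {a..b}" using GK[of y] by (metis atLeastAtMost_iff image_eqI)
    qed (use smG in \<open>auto simp: strict_mono_less_eq\<close>)
    also have "emeasure lborel {G a..G b} = ennreal (G b - G a)"
      using smG that by (simp add: strict_mono_less_eq)
    finally show ?thesis .
  qed
  have fin: "AE x in lborel. d x * indicator {a..b} x \<noteq> \<infinity>" if "a \<le> b" for a b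
    by (rule nn_integral_noteq_infinite) (use nn[OF that] d(1) in auto)
  \<comment> \<open>The density takes values in \<open>ennreal\<close>, and \<open>enn2real\<close>
    sends infinity to 0; by \<open>fin\<close> this changes it only on a null set of each
    interval.\<close>
  have int: "((\<lambda>x. enn2real (d x)) has_integral G b - G a) {a..b}" if ab: "a \<le> b" for a b
  proof -
    have "(\<integral>\<^sup>+x. ennreal (enn2real (d x) * indicator {a..b} x) \<partial>lborel)
        = (\<integral>\<^sup>+x. d x * indicator {a..b} x \<partial>lborel)"
    proof (rule nn_integral_cong_AE)
      show "AE x in lborel. ennreal (enn2real (d x) * indicator {a..b} x) = d x * indicator {a..b} x"
        using fin[OF ab] by eventually_elim (auto simp: indicator_def less_top)
    qed
    then have "((\<lambda>x. enn2real (d x) * indicator {a..b} x) has_integral G b - G a) UNIV"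
      using nn[OF ab] d(1) G_diff[OF ab] ab
      by (intro nn_integral_has_integral) auto
    then show ?thesis
      using has_integral_restrict_UNIV[of "{a..b}" "\<lambda>x. enn2real (d x)"]
      by (simp add: indicator_def of_bool_def if_distrib cong: if_cong)
  qed
  show thesis
  proof
    fix a b :: real assume ab: "a \<le> b"
    have "((\<lambda>x. L + 1) has_integral (L + 1) * (b - a)) {a..b}"
      using has_integral_const_real[of "L + 1" a b] ab by (simp add: mult.commute)
    from has_integral_diff[OF int[OF ab] this]
    show "((\<lambda>x. enn2real (d x) - (L + 1)) has_integral f b - f a) {a..b}"
      by (simp add: G_def algebra_simps)
  qed
qed

text \<open>Lebesgue differentiation with averages over cubes whose lower corner is the point
  itself: in one dimension these are the right-hand difference quotients of \<open>f\<close>. The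
  left-hand ones are recovered later by reflection.\<close>

lemma integral_right_derivative:
  fixes f :: "real \<Rightarrow> real"
  assumes r: "\<And>a b. a \<le> b \<Longrightarrow> (r has_integral f b - f a) {a..b}"
  obtains N where "negligible N"
    "\<And>x. x \<notin> N \<Longrightarrow> ((\<lambda>h. (f (x + h) - f x) / h) \<longlongrightarrow> r x) (at_right 0)"
proof -
  have int: "r integrable_on cbox a b" for a b
    using r[of a b] by (cases "a \<le> b") (auto simp: integrable_on_def)
  show thesis
  proof (rule integrable_ccontinuous_explicit[OF int], goal_cases)
    case N: (1 N)
    have "((\<lambda>h. (f (x + h) - f x) / h) \<longlongrightarrow> r x) (at_right 0)" if nx: "x \<notin> N" for x
    proof (rule tendstoI)
      fix e :: real assume "e > 0"
      then obtain d where d: "d > 0" "\<forall>h. 0 < h \<and> h < d \<longrightarrow>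
          norm (integral (cbox x (x + h *\<^sub>R One)) r /\<^sub>R h ^ DIM(real) - r x) < e"
        using N(2)[OF nx] by blast
      show "\<forall>\<^sub>F h in at_right 0. dist ((f (x + h) - f x) / h) (r x) < e"
        unfolding eventually_at_right_field
      proof (intro exI[of _ d] conjI allI impI)
        fix h :: real assume h: "0 < h" "h < d"
        then have "integral {x..x + h} r = f (x + h) - f x"
          using r[of x "x + h"] by (auto intro: integral_unique)
        then show "dist ((f (x + h) - f x) / h) (r x) < e"
          using d(2) h by (auto simp: dist_real_def divide_inverse mult.commute)
      qed (use d in auto)
    qed
    with N(1) show thesis by (rule that)
  qed
qed

lemma lipschitz_real_differentiable_ae:
  fixes f :: "real \<Rightarrow> real"
  assumes lip: "\<And>x y. \<bar>f x - f y\<bar> \<le> L * \<bar>x - y\<bar>"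
  shows "negligible {x. \<not> f differentiable (at x)}"
proof -
  obtain r where r: "\<And>a b. a \<le> b \<Longrightarrow> (r has_integral f b - f a) {a..b}"
    using lipschitz_real_increment_has_integral[OF lip] by blast
  obtain N1 where N1: "negligible N1"
    "\<And>x. x \<notin> N1 \<Longrightarrow> ((\<lambda>h. (f (x + h) - f x) / h) \<longlongrightarrow> r x) (at_right 0)"
    using integral_right_derivative[OF r] by blast
  \<comment> \<open>The function \<open>\<lambda>x. - f (- x)\<close> has density
    \<open>r (- x)\<close>. Its right-hand derivative at \<open>- x\<close> is the left-hand
    derivative of \<open>f\<close> at \<open>x\<close>, with the same value \<open>r x\<close> as on
    the right, so the two sides agree automatically.\<close>
  have r': "((\<lambda>x. r (- x)) has_integral (- f (- b)) - (- f (- a))) {a..b}" if "a \<le> b" for a b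
    using r[of "- b" "- a"] that by (subst has_integral_reflect_real[symmetric]) auto
  obtain N2 where N2: "negligible N2"
    "\<And>x. x \<notin> N2 \<Longrightarrow> ((\<lambda>h. (- f (- (x + h)) - (- f (- x))) / h) \<longlongrightarrow> r (- x)) (at_right 0)"
    using integral_right_derivative[of "\<lambda>x. r (- x)" "\<lambda>x. - f (- x)", OF r'] by blast
  have "f differentiable (at x)" if x: "x \<notin> N1 \<union> uminus ` N2" for x
  proof -
    have "- x \<notin> N2" using x by force
    from N2(2)[OF this]
    have "((\<lambda>h. (f (x + - h) - f x) / (- h)) \<longlongrightarrow> r x) (at_right 0)"
      by (simp add: minus_divide_left algebra_simps)
    then have "((\<lambda>h. (f (x + h) - f x) / h) \<longlongrightarrow> r x) (at_left 0)"
      by (subst filterlim_at_left_to_right) (simp add: o_def)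
    moreover have "((\<lambda>h. (f (x + h) - f x) / h) \<longlongrightarrow> r x) (at_right 0)"
      using N1(2) x by blast
    ultimately have "(f has_real_derivative r x) (at x)"
      unfolding DERIV_def using filterlim_split_at by blast
    then show ?thesis using real_differentiable_def by blast
  qed
  then have "{x. \<not> f differentiable (at x)} \<subseteq> N1 \<union> uminus ` N2" by blast
  moreover have "negligible (uminus ` N2)"
    by (rule negligible_differentiable_image_negligible) (auto simp: N2 intro!: derivative_intros)
  ultimately show ?thesis using N1(1) negligible_Un negligible_subset by blast
qed

text \<open>Differentiability along \<open>v\<close> is the Cauchy criterion for the quotients
  \<open>q x t\<close> as \<open>t\<close> tends to 0. For fixed \<open>s\<close> and
  \<open>t\<close> the condition is closed in \<open>x\<close>, so the uncountable intersection over
  them stays closed and only \<open>k\<close> and \<open>m\<close> have to be countable. Tonelli's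
  theorem will rely on this measurability.\<close>

lemma sets_borel_not_directional_differentiable:
  fixes f :: "'a::euclidean_space \<Rightarrow> real"
  assumes cont: "continuous_on UNIV f"
  shows "{x. \<not> (\<lambda>t. f (x + t *\<^sub>R v)) differentiable (at 0)} \<in> sets borel"
proof -
  define q where "q x t = (f (x + t *\<^sub>R v) - f x) / t" for x t
  define B where "B k m = (\<Inter>s\<in>{s. 0 < \<bar>s\<bar> \<and> \<bar>s\<bar> < inverse (real (Suc m))}.
      \<Inter>t\<in>{s. 0 < \<bar>s\<bar> \<and> \<bar>s\<bar> < inverse (real (Suc m))}.
        {x. \<bar>q x s - q x t\<bar> \<le> inverse (real (Suc k))})" for k m
  have cq: "continuous_on UNIV (\<lambda>x. q x t)" for t
    unfolding q_def divide_inverse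
    by (intro continuous_intros continuous_on_compose2[OF cont]) auto
  have "closed (B k m)" for k m
    unfolding B_def by (intro closed_INT ballI closed_Collect_le continuous_intros cq)
  then have "(\<Inter>k. \<Union>m. B k m) \<in> sets borel" by (intro sets.countable_INT' sets.countable_UN'') auto
  moreover have "(\<lambda>t. f (x + t *\<^sub>R v)) differentiable (at 0) \<longleftrightarrow> x \<in> (\<Inter>k. \<Union>m. B k m)" for x
  proof -
    have "(\<lambda>t. f (x + t *\<^sub>R v)) differentiable (at 0) \<longleftrightarrow> (\<exists>D. (q x \<longlongrightarrow> D) (at 0))"
      unfolding real_differentiable_def DERIV_def q_def by simp
    also have "\<dots> \<longleftrightarrow> x \<in> (\<Inter>k. \<Union>m. B k m)"
    proof
      assume "\<exists>D. (q x \<longlongrightarrow> D) (at 0)"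
      then obtain D where D: "(q x \<longlongrightarrow> D) (at 0)" by blast
      show "x \<in> (\<Inter>k. \<Union>m. B k m)"
      proof (intro INT_I UN_iff[THEN iffD2])
        fix k :: nat
        have "inverse (real (Suc k)) / 2 > 0" by simp
        then have "\<forall>\<^sub>F t in at 0. dist (q x t) D < inverse (real (Suc k)) / 2"
          using D tendstoD by blast
        then obtain d where d: "d > 0"
          "\<And>t. t \<noteq> 0 \<Longrightarrow> \<bar>t\<bar> < d \<Longrightarrow> dist (q x t) D < inverse (real (Suc k)) / 2"
          unfolding eventually_at by auto
        obtain m where m: "inverse (real (Suc m)) < d" using reals_Archimedean[OF d(1)] by blast
        have "x \<in> B k m" unfolding B_def
        proof (clarsimp simp del: of_nat_Suc)
          fix s t :: real assume "s \<noteq> 0" "t \<noteq> 0" "\<bar>s\<bar> < inverse (real (Suc m))" "\<bar>t\<bar> < inverse (real (Suc m))"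
          then have "dist (q x s) D < inverse (real (Suc k)) / 2" "dist (q x t) D < inverse (real (Suc k)) / 2"
            using d(2) m by (auto simp del: of_nat_Suc)
          then show "\<bar>q x s - q x t\<bar> \<le> inverse (real (Suc k))"
            unfolding dist_real_def by linarith
        qed
        then show "\<exists>m\<in>UNIV. x \<in> B k m" by blast
      qed
    next
      assume x: "x \<in> (\<Inter>k. \<Union>m. B k m)"
      have close: "\<exists>d>0. \<forall>s t. 0 < \<bar>s\<bar> \<and> \<bar>s\<bar> < d \<and> 0 < \<bar>t\<bar> \<and> \<bar>t\<bar> < d \<longrightarrow> \<bar>q x s - q x t\<bar> < e"
        if e: "e > 0" for e
      proof -
        obtain k where k: "inverse (real (Suc k)) < e" using reals_Archimedean[OF e] by blast
        obtain m where "x \<in> B k m" using x by blast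
        then have "\<bar>q x s - q x t\<bar> \<le> inverse (real (Suc k))"
          if "0 < \<bar>s\<bar> \<and> \<bar>s\<bar> < inverse (real (Suc m)) \<and> 0 < \<bar>t\<bar> \<and> \<bar>t\<bar> < inverse (real (Suc m))" for s t
          using that unfolding B_def by blast
        then show ?thesis using k
          by (intro exI[of _ "inverse (real (Suc m))"]) (fastforce simp del: of_nat_Suc)
      qed
      have "cauchy_filter (filtermap (q x) (at 0))"
        unfolding cauchy_filter_metric
      proof (intro allI impI)
        fix e :: real assume "e > 0"
        then obtain d where "d > 0" and
          d: "\<And>s t. 0 < \<bar>s\<bar> \<and> \<bar>s\<bar> < d \<and> 0 < \<bar>t\<bar> \<and> \<bar>t\<bar> < d \<Longrightarrow> \<bar>q x s - q x t\<bar> < e"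
          using close by blast
        let ?P = "\<lambda>y. \<exists>t. 0 < \<bar>t\<bar> \<and> \<bar>t\<bar> < d \<and> y = q x t"
        have "eventually ?P (filtermap (q x) (at 0))"
          unfolding eventually_filtermap eventually_at using \<open>d > 0\<close> by (intro exI[of _ d]) auto
        moreover have "\<forall>y z. ?P y \<and> ?P z \<longrightarrow> dist y z < e"
          using d by (auto simp: dist_real_def)
        ultimately show "\<exists>P. eventually P (filtermap (q x) (at 0)) \<and> (\<forall>x y. P x \<and> P y \<longrightarrow> dist x y < e)"
          by blast
      qed
      then have "\<exists>D. filtermap (q x) (at 0) \<le> nhds D"
        using complete_uniform[of "UNIV :: real set"] complete_UNIV
        by (auto simp: filtermap_bot_iff trivial_limit_at)
      then show "\<exists>D. (q x \<longlongrightarrow> D) (at 0)" by (simp add: filterlim_def)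
    qed
    finally show ?thesis .
  qed
  ultimately have "- {x. \<not> (\<lambda>t. f (x + t *\<^sub>R v)) differentiable (at 0)} \<in> sets borel"
    by (simp add: set_eq_iff Compl_eq INTER_eq UNION_eq)
  then show ?thesis using borel_comp by fastforce
qed

text \<open>
  Translation invariance replaces a choice of coordinates adapted to \<open>v\<close>: the measure of the bad set
  is the integral over \<open>t\<close> in \<open>[0, 1]\<close> of the measures of its translates by \<open>t *\<^sub>R v\<close>, and by Tonelli
  this vanishes because the bad set meets every line in direction \<open>v\<close> in a null set.
\<close>
lemma negligible_not_directional_differentiable:
  fixes f :: "'a::euclidean_space \<Rightarrow> real"
  assumes lip: "\<And>x y. \<bar>f x - f y\<bar> \<le> L * norm (x - y)"
  shows "negligible {x. \<not> (\<lambda>t. f (x + t *\<^sub>R v)) differentiable (at 0)}" (is "negligible ?B")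
proof -
  have L0: "L \<ge> 0"
  proof -
    obtain b :: 'a where "b \<in> Basis" using nonempty_Basis by blast
    then show ?thesis using lip[of b 0] by simp
  qed
  have "continuous_on UNIV f"
    by (rule lipschitz_on_continuous_on[of L]) (use lip L0 in \<open>auto intro!: lipschitz_onI simp: dist_norm\<close>)
  then have B: "?B \<in> sets borel" by (rule sets_borel_not_directional_differentiable)
  have line: "emeasure lborel {t. x + t *\<^sub>R v \<in> ?B} = 0" for x
  proof -
    let ?g = "\<lambda>t. f (x + t *\<^sub>R v)"
    have "\<bar>?g s - ?g t\<bar> \<le> (L * norm v) * \<bar>s - t\<bar>" for s t
      using lip[of "x + s *\<^sub>R v" "x + t *\<^sub>R v"] by (simp add: scaleR_left_diff_distrib[symmetric] mult_ac)
    then have "negligible {t. \<not> ?g differentiable (at t)}"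
      by (rule lipschitz_real_differentiable_ae)
    moreover have "{t. x + t *\<^sub>R v \<in> ?B} = {t. \<not> ?g differentiable (at t)}"
    proof -
      have "(\<lambda>s. f (x + t *\<^sub>R v + s *\<^sub>R v)) differentiable (at 0) \<longleftrightarrow> ?g differentiable (at t)" for t
      proof -
        have "(\<lambda>s. f (x + t *\<^sub>R v + s *\<^sub>R v)) = (\<lambda>s. ?g (s + t))"
          by (simp add: scaleR_left_distrib add_ac)
        then show ?thesis
          using DERIV_shift[of ?g _ 0 t] by (simp add: real_differentiable_def)
      qed
      then show ?thesis by simp
    qed
    moreover have "(\<lambda>t. x + t *\<^sub>R v) -` ?B \<inter> space borel \<in> sets borel"
      using B by (intro measurable_sets[of _ borel borel]) simp_all
    ultimately show ?thesis
      by (simp add: vimage_def negligible_iff_emeasure0)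
  qed
  have m[measurable]: "(\<lambda>(x, t). indicator ?B (x + t *\<^sub>R v) :: ennreal) \<in> borel_measurable (lborel \<Otimes>\<^sub>M lborel)"
    using B by (simp add: split_def)
  have "emeasure lborel ?B = (\<integral>\<^sup>+t. emeasure lborel ?B * indicator {0..1} (t::real) \<partial>lborel)"
    by (simp add: nn_integral_cmult_indicator)
  also have "\<dots> = (\<integral>\<^sup>+t. (\<integral>\<^sup>+x. indicator ?B (x + t *\<^sub>R v) \<partial>lborel) * indicator {0..1} t \<partial>lborel)"
  proof -
    have "(\<integral>\<^sup>+x. indicator ?B (x + t *\<^sub>R v) \<partial>lborel) = emeasure lborel ?B" for t
    proof -
      have "emeasure lborel ?B = (\<integral>\<^sup>+x. indicator ?B x \<partial>distr lborel borel ((+) (t *\<^sub>R v)))"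
        using B by (simp add: lborel_distr_plus)
      also have "\<dots> = (\<integral>\<^sup>+x. indicator ?B (t *\<^sub>R v + x) \<partial>lborel)"
        using B by (subst nn_integral_distr) auto
      finally show ?thesis by (simp add: add.commute)
    qed
    then show ?thesis by simp
  qed
  also have "\<dots> \<le> (\<integral>\<^sup>+t. (\<integral>\<^sup>+x. indicator ?B (x + t *\<^sub>R v) \<partial>lborel) \<partial>lborel)"
    by (intro nn_integral_mono) (auto simp: indicator_def)
  also have "\<dots> = (\<integral>\<^sup>+x. (\<integral>\<^sup>+t. indicator ?B (x + t *\<^sub>R v) \<partial>lborel) \<partial>lborel)"
    using lborel_pair.Fubini'[OF m] by simp
  also have "\<dots> = (\<integral>\<^sup>+x. 0 \<partial>(lborel :: 'a measure))"
  proof (rule nn_integral_cong)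
    fix x :: 'a
    have "{t. x + t *\<^sub>R v \<in> ?B} \<in> sets lborel"
      using measurable_sets[of "\<lambda>t. x + t *\<^sub>R v" borel borel ?B] B by (simp add: vimage_def)
    then have "(\<integral>\<^sup>+t. indicator {t. x + t *\<^sub>R v \<in> ?B} t \<partial>lborel) = 0"
      using line by simp
    then show "(\<integral>\<^sup>+t. indicator ?B (x + t *\<^sub>R v) \<partial>lborel) = 0"
      by (simp add: indicator_def)
  qed
  finally have "emeasure lborel ?B = 0" by simp
  then show ?thesis using B by (simp add: negligible_iff_emeasure0)
qed

section \<open>Additivity of directional derivatives in the direction\<close>

lemma lborel_integral_translate:
  fixes f :: "'a::euclidean_space \<Rightarrow> real"
  assumes [measurable]: "f \<in> borel_measurable borel"
  shows "(\<integral>x. f (c + x) \<partial>lborel) = (\<integral>x. f x \<partial>lborel)"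
    and "integrable lborel (\<lambda>x. f (c + x)) \<longleftrightarrow> integrable lborel f"
  using integral_distr[of "(+) c" lborel borel f] integrable_distr_eq[of "(+) c" lborel borel f]
  by (simp_all add: lborel_distr_plus)

lemma integrable_bounded_indicator:
  fixes f :: "'a::euclidean_space \<Rightarrow> real"
  assumes [measurable]: "f \<in> borel_measurable borel" "Q \<in> sets borel"
    and "bounded Q" "\<And>x. \<bar>f x\<bar> \<le> K"
  shows "integrable lborel (\<lambda>x. indicator Q x * f x)"
proof (rule Bochner_Integration.integrable_bound[where f = "\<lambda>x. K * indicator Q x"])
  have "emeasure lborel Q < \<infinity>" using emeasure_bounded_finite[OF \<open>bounded Q\<close>] by simp
  then show "integrable lborel (\<lambda>x. K * indicator Q x)" by simp
  show "AE x in lborel. norm (indicator Q x * f x) \<le> norm (K * indicator Q x)"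
    using order_trans[OF assms(4) abs_ge_self] by (intro AE_I2) (auto simp: indicator_def)
qed simp

text \<open>By Lebesgue differentiation \<open>g\<close> is almost everywhere the limit of its
  averages over small cubes, and these all vanish.\<close>

lemma negligible_if_box_integrals_zero:
  fixes g :: "'a::euclidean_space \<Rightarrow> real"
  assumes zero: "\<And>a b. (g has_integral 0) (cbox a b)"
  shows "negligible {x. g x \<noteq> 0}"
proof -
  have int: "g integrable_on cbox a b" for a b using zero by blast
  show ?thesis
  proof (rule integrable_ccontinuous_explicit[OF int], goal_cases)
    case N: (1 N)
    have "g x = 0" if nx: "x \<notin> N" for x
    proof (rule ccontr)
      assume "g x \<noteq> 0"
      then obtain d where d: "d > 0" "\<forall>h. 0 < h \<and> h < d \<longrightarrow>
          norm (integral (cbox x (x + h *\<^sub>R One)) g /\<^sub>R h ^ DIM('a) - g x) < norm (g x)"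
        using N(2)[OF nx, of "norm (g x)"] by auto
      have "integral (cbox x (x + (d / 2) *\<^sub>R One)) g = 0" using zero by (rule integral_unique)
      then show False using d(2)[rule_format, of "d / 2"] d(1) by simp
    qed
    then have "{x. g x \<noteq> 0} \<subseteq> N" by blast
    then show ?case using N(1) negligible_subset by blast
  qed
qed

text \<open>
  The defect of additivity has zero integral over every box: the difference quotients of \<open>f\<close> in
  direction \<open>v\<close> at \<open>x + c *\<^sub>R w\<close> and at \<open>x\<close> differ by a translation that tends to zero with \<open>c\<close>.
\<close>
lemma negligible_not_directional_derivative_add:
  fixes f :: "'a::euclidean_space \<Rightarrow> real"
  assumes lip: "\<And>x y. \<bar>f x - f y\<bar> \<le> L * norm (x - y)"
  shows "negligible {x. \<not> (\<exists>a b. ((\<lambda>t. f (x + t *\<^sub>R v)) has_real_derivative a) (at 0) \<and>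
     ((\<lambda>t. f (x + t *\<^sub>R w)) has_real_derivative b) (at 0) \<and>
     ((\<lambda>t. f (x + t *\<^sub>R (v + w))) has_real_derivative a + b) (at 0))}"
    (is "negligible ?Bad")
proof -
  have L0: "L \<ge> 0"
  proof -
    obtain b :: 'a where "b \<in> Basis" using nonempty_Basis by blast
    then show ?thesis using lip[of b 0] by simp
  qed
  have contf: "continuous_on UNIV f"
    by (rule lipschitz_on_continuous_on[of L]) (use lip L0 in \<open>auto intro!: lipschitz_onI simp: dist_norm\<close>)
  have contf': "continuous_on A (\<lambda>x. f (x + u))" for A u
    by (intro continuous_on_compose2[OF contf] continuous_intros) auto
  \<comment> \<open>A fixed sequence of steps, so that the limits are measurable and dominated
    convergence applies; \<open>c n \<le> 1\<close> keeps all the translations by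
    \<open>c n *\<^sub>R w\<close> within \<open>norm w\<close>.\<close>
  define c where "c n = inverse (real (Suc n))" for n
  have c_pos: "c n > 0" "c n \<le> 1" for n by (simp_all add: c_def inverse_le_1_iff)
  have c_lim: "c \<longlonglongrightarrow> 0" unfolding c_def by (rule LIMSEQ_inverse_real_of_nat)
  define q where "q u n x = (f (x + c n *\<^sub>R u) - f x) / c n" for u n x
  have q_meas[measurable]: "q u n \<in> borel_measurable borel" for u n
    unfolding q_def
    by (intro borel_measurable_divide borel_measurable_diff borel_measurable_continuous_onI contf' contf) auto
  have q_bound: "\<bar>q u n x\<bar> \<le> L * norm u" for u n x
    using lip[of "x + c n *\<^sub>R u" x] c_pos[of n] by (simp add: q_def abs_divide divide_le_eq mult_ac)
  define N where "N = (\<Union>u\<in>{v, w, v + w}. {x. \<not> (\<lambda>t. f (x + t *\<^sub>R u)) differentiable (at 0)})"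
  have N_borel: "N \<in> sets borel" unfolding N_def
    by (intro sets.finite_UN sets_borel_not_directional_differentiable contf) auto
  have N_null: "negligible N" unfolding N_def
    by (intro negligible_Union_nat negligible_Union) (auto intro!: negligible_not_directional_differentiable[OF lip])
  define D where "D u x = lim (\<lambda>n. q u n x)" for u x
  have q_lim: "(\<lambda>n. q u n x) \<longlonglongrightarrow> a" if "((\<lambda>t. f (x + t *\<^sub>R u)) has_real_derivative a) (at 0)" for u x a
  proof -
    have "((\<lambda>t. (f (x + t *\<^sub>R u) - f x) / t) \<longlongrightarrow> a) (at 0)"
      using that by (simp add: DERIV_def)
    moreover have "filterlim c (at 0) sequentially"
      using c_lim c_pos by (auto simp: filterlim_at intro!: always_eventually) (metis less_irrefl)
    ultimately show ?thesis unfolding q_def by (rule filterlim_compose)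
  qed
  have D: "((\<lambda>t. f (x + t *\<^sub>R u)) has_real_derivative D u x) (at 0) \<and> (\<lambda>n. q u n x) \<longlonglongrightarrow> D u x"
    if "x \<notin> N" "u \<in> {v, w, v + w}" for u x
  proof -
    have "(\<lambda>t. f (x + t *\<^sub>R u)) differentiable (at 0)" using that unfolding N_def by blast
    then obtain a where a: "((\<lambda>t. f (x + t *\<^sub>R u)) has_real_derivative a) (at 0)"
      by (auto simp: real_differentiable_def)
    have "D u x = a" unfolding D_def using q_lim[OF a] by (rule limI)
    then show ?thesis using a q_lim[OF a] by simp
  qed
  \<comment> \<open>On \<open>N\<close> the limits in \<open>D\<close> may fail to exist; the
    indicator sets \<open>g\<close> to 0 there, which keeps it bounded everywhere.\<close>
  define g where "g x = indicator (- N) x * (D (v + w) x - D w x - D v x)" for x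
  have g_meas[measurable]: "g \<in> borel_measurable borel"
    unfolding g_def D_def using N_borel by measurable
  define K where "K = L * norm (v + w) + L * norm w + L * norm v"
  define h where "h n x = q (v + w) n x - q w n x - q v n x" for n x
  have h_bound: "\<bar>h n x\<bar> \<le> K" for n x
    unfolding h_def K_def using q_bound[of "v + w" n x] q_bound[of w n x] q_bound[of v n x] by linarith
  have K0: "K \<ge> 0" using h_bound[of 0 0] by linarith
  have h_lim: "(\<lambda>n. h n x) \<longlonglongrightarrow> g x" if "x \<notin> N" for x
    unfolding h_def g_def using D[OF that] that by (auto intro!: tendsto_diff)
  have g_bound: "\<bar>g x\<bar> \<le> K" for x
  proof (cases "x \<in> N")
    case False
    show ?thesis
      by (rule LIMSEQ_le_const2[OF tendsto_rabs[OF h_lim[OF False]]]) (use h_bound in auto)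
  qed (simp add: g_def K0)
  have AE_N: "AE x in lborel. x \<notin> N"
    using N_null N_borel
    by (intro AE_not_in) (simp add: null_sets_def negligible_iff_emeasure0)
  have zero: "(g has_integral 0) (cbox a b)" for a b
  proof -
    let ?Q = "cbox a b"
    have intQ: "integrable lborel (\<lambda>x. indicator ?Q x * g x)"
      by (rule integrable_bounded_indicator[OF _ _ _ g_bound]) auto
    have lim1: "(\<lambda>n. \<integral>x. indicator ?Q x * h n x \<partial>lborel) \<longlonglongrightarrow> (\<integral>x. indicator ?Q x * g x \<partial>lborel)"
    proof (rule integral_dominated_convergence[where w = "\<lambda>x. indicator ?Q x * K"])
      show "integrable lborel (\<lambda>x. indicator ?Q x * K)"
        by (rule integrable_bounded_indicator[where K = K]) (use K0 in auto)
      show "AE x in lborel. (\<lambda>n. indicator ?Q x * h n x) \<longlonglongrightarrow> indicator ?Q x * g x"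
        using AE_N by eventually_elim (intro tendsto_mult tendsto_const h_lim)
      show "AE x in lborel. norm (indicator ?Q x * h n x) \<le> indicator ?Q x * K" for n
        using h_bound by (intro AE_I2) (auto simp: indicator_def)
    qed (auto simp: h_def)
    \<comment> \<open>The quotients along \<open>v + w\<close> and \<open>w\<close> differ by the
      quotient along \<open>v\<close> at the translated point. A change of variables moves the
      translation onto the box, so only the indicator of the box has to vary continuously, which it
      does off the frontier.\<close>
    have shift: "(\<integral>x. indicator ?Q x * h n x \<partial>lborel)
        = (\<integral>y. (indicator ?Q (y - c n *\<^sub>R w) - indicator ?Q y) * q v n y \<partial>lborel)" for n
    proof -
      have h_eq: "h n x = q v n (c n *\<^sub>R w + x) - q v n x" for x
        using c_pos[of n] by (simp add: h_def q_def field_simps scaleR_add_right add_ac)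
      let ?F = "\<lambda>y. indicator ?Q (y - c n *\<^sub>R w) * q v n y"
      have m: "?F \<in> borel_measurable borel" by measurable
      have i1: "integrable lborel (\<lambda>x. indicator ?Q x * q v n x)"
        by (rule integrable_bounded_indicator[OF _ _ _ q_bound]) auto
      have i2: "integrable lborel (\<lambda>x. indicator ?Q x * q v n (c n *\<^sub>R w + x))"
        by (rule integrable_bounded_indicator[OF _ _ _ q_bound]) auto
      have i3: "integrable lborel ?F"
        using i2 lborel_integral_translate(2)[OF m, of "c n *\<^sub>R w"] by simp
      have "(\<integral>x. indicator ?Q x * h n x \<partial>lborel)
         = (\<integral>x. indicator ?Q x * q v n (c n *\<^sub>R w + x) \<partial>lborel) - (\<integral>x. indicator ?Q x * q v n x \<partial>lborel)"
        unfolding h_eq right_diff_distrib using i1 i2 by (rule Bochner_Integration.integral_diff[rotated])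
      also have "(\<integral>x. indicator ?Q x * q v n (c n *\<^sub>R w + x) \<partial>lborel) = (\<integral>y. ?F y \<partial>lborel)"
        using lborel_integral_translate(1)[OF m, of "c n *\<^sub>R w"] by simp
      also have "\<dots> - (\<integral>x. indicator ?Q x * q v n x \<partial>lborel)
          = (\<integral>y. (indicator ?Q (y - c n *\<^sub>R w) - indicator ?Q y) * q v n y \<partial>lborel)"
        unfolding left_diff_distrib using i3 i1 by (rule Bochner_Integration.integral_diff[symmetric])
      finally show ?thesis .
    qed
    obtain R where R: "\<And>x. x \<in> ?Q \<Longrightarrow> norm x \<le> R" using bounded_cbox bounded_iff by metis
    have lim2: "(\<lambda>n. \<integral>y. (indicator ?Q (y - c n *\<^sub>R w) - indicator ?Q y) * q v n y \<partial>lborel)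
        \<longlonglongrightarrow> (\<integral>y. 0 \<partial>(lborel :: 'a measure))"
    proof (rule integral_dominated_convergence[where w = "\<lambda>x. indicator (cball 0 (R + norm w)) x * (L * norm v)"])
      show "integrable lborel (\<lambda>x. indicator (cball 0 (R + norm w)) x * (L * norm v))"
        by (rule integrable_bounded_indicator[where K = "L * norm v"]) (use L0 in auto)
      have "negligible (frontier ?Q)" by (simp add: negligible_convex_frontier)
      then have "AE y in lborel. y \<notin> frontier ?Q"
        by (intro AE_not_in) (simp add: null_sets_def negligible_iff_emeasure0 borel_closed)
      then show "AE y in lborel. (\<lambda>n. (indicator ?Q (y - c n *\<^sub>R w) - indicator ?Q y) * q v n y) \<longlonglongrightarrow> 0"
      proof eventually_elim
        case (elim y)
        have "(\<lambda>n. y - c n *\<^sub>R w) \<longlonglongrightarrow> y - 0 *\<^sub>R w"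
          by (intro tendsto_intros c_lim)
        then have l: "(\<lambda>n. y - c n *\<^sub>R w) \<longlonglongrightarrow> y" by simp
        have "y \<in> interior ?Q \<or> y \<in> - closure ?Q" using elim by (auto simp: frontier_def)
        then have "\<forall>\<^sub>F n in sequentially. y - c n *\<^sub>R w \<in> ?Q \<longleftrightarrow> y \<in> ?Q"
        proof
          assume y: "y \<in> interior ?Q"
          have "\<forall>\<^sub>F n in sequentially. y - c n *\<^sub>R w \<in> interior ?Q"
            using topological_tendstoD[OF l open_interior y] .
          then show ?thesis by eventually_elim (use y interior_subset in blast)
        next
          assume y: "y \<in> - closure ?Q"
          have "\<forall>\<^sub>F n in sequentially. y - c n *\<^sub>R w \<in> - closure ?Q"
            using topological_tendstoD[OF l _ y] open_Compl[OF closed_closure] by blast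
          then show ?thesis by eventually_elim (use y closure_subset in blast)
        qed
        then have "\<forall>\<^sub>F n in sequentially. 0 = (indicator ?Q (y - c n *\<^sub>R w) - indicator ?Q y) * q v n y"
          by eventually_elim (simp add: indicator_def)
        then show ?case by (rule tendsto_eventually[OF eventually_mono]) simp
      qed
      show "AE y in lborel. norm ((indicator ?Q (y - c n *\<^sub>R w) - indicator ?Q y) * q v n y)
          \<le> indicator (cball 0 (R + norm w)) y * (L * norm v)" for n
      proof (rule AE_I2)
        fix y
        have *: "norm y \<le> R + norm w" if "y - c n *\<^sub>R w \<in> ?Q"
        proof -
          have "norm y \<le> norm (y - c n *\<^sub>R w) + norm (c n *\<^sub>R w)" by (metis diff_add_cancel norm_triangle_ineq)
          also have "norm (c n *\<^sub>R w) \<le> norm w" using c_pos[of n] by (simp add: mult_left_le_one_le)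
          finally show ?thesis using R[OF that] by simp
        qed
        have **: "norm y \<le> R + norm w" if "y \<in> ?Q"
          using R[OF that] by (smt (verit) norm_ge_zero)
        show "norm ((indicator ?Q (y - c n *\<^sub>R w) - indicator ?Q y) * q v n y)
            \<le> indicator (cball 0 (R + norm w)) y * (L * norm v)"
          using * ** q_bound[of v n y] L0 by (auto simp: indicator_def abs_mult)
      qed
    qed auto
    have "(\<integral>x. indicator ?Q x * g x \<partial>lborel) = 0"
      using LIMSEQ_unique[OF lim1] lim2 unfolding shift by simp
    then have "(LINT x:?Q|lborel. g x) = 0" by (simp add: set_lebesgue_integral_def)
    moreover have "set_integrable lborel ?Q g" using intQ by (simp add: set_integrable_def)
    ultimately show ?thesis using has_integral_set_lebesgue by (metis set_borel_integral_eq_integral has_integral_integral)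
  qed
  have "?Bad \<subseteq> N \<union> {x. g x \<noteq> 0}"
  proof
    fix x assume x: "x \<in> ?Bad"
    show "x \<in> N \<union> {x. g x \<noteq> 0}"
    proof (rule ccontr)
      assume "x \<notin> N \<union> {x. g x \<noteq> 0}"
      then have n: "x \<notin> N" and "D (v + w) x = D v x + D w x" by (auto simp: g_def)
      then have "((\<lambda>t. f (x + t *\<^sub>R v)) has_real_derivative D v x) (at 0) \<and>
         ((\<lambda>t. f (x + t *\<^sub>R w)) has_real_derivative D w x) (at 0) \<and>
         ((\<lambda>t. f (x + t *\<^sub>R (v + w))) has_real_derivative D v x + D w x) (at 0)"
        using D[OF n, of v] D[OF n, of w] D[OF n, of "v + w"] by simp
      then show False using x by blast
    qed
  qed
  then show ?thesis
    using N_null negligible_if_box_integrals_zero[OF zero] negligible_Un negligible_subset by blast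
qed

text \<open>The null set depends on the coefficients \<open>c\<close>, so the result serves only for
  countably many directions at once. With \<open>S = Basis\<close> it says that the derivative is
  the inner product with the vector of partial derivatives.\<close>

lemma negligible_not_directional_derivative_sum:
  fixes f :: "'a::euclidean_space \<Rightarrow> real"
  assumes lip: "\<And>x y. \<bar>f x - f y\<bar> \<le> L * norm (x - y)" and "finite S"
  shows "negligible {x. \<not> ((\<lambda>t. f (x + t *\<^sub>R (\<Sum>b\<in>S. c b *\<^sub>R b))) has_real_derivative
     (\<Sum>b\<in>S. c b * deriv (\<lambda>t. f (x + t *\<^sub>R b)) 0)) (at 0)}" (is "negligible (?Bad S)")
  using \<open>finite S\<close>
proof induction
  case empty
  then show ?case by simp
next
  case (insert u S)
  define s where "s = (\<Sum>b\<in>S. c b *\<^sub>R b)"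
  let ?B1 = "{x. \<not> (\<exists>a b. ((\<lambda>t. f (x + t *\<^sub>R (c u *\<^sub>R u))) has_real_derivative a) (at 0) \<and>
     ((\<lambda>t. f (x + t *\<^sub>R s)) has_real_derivative b) (at 0) \<and>
     ((\<lambda>t. f (x + t *\<^sub>R (c u *\<^sub>R u + s))) has_real_derivative a + b) (at 0))}"
  let ?B2 = "{x. \<not> (\<lambda>t. f (x + t *\<^sub>R u)) differentiable (at 0)}"
  have "?Bad (insert u S) \<subseteq> ?B1 \<union> ?B2 \<union> ?Bad S"
  proof
    fix x assume x: "x \<in> ?Bad (insert u S)"
    show "x \<in> ?B1 \<union> ?B2 \<union> ?Bad S"
    proof (rule ccontr)
      assume n: "x \<notin> ?B1 \<union> ?B2 \<union> ?Bad S"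
      then obtain a b where a: "((\<lambda>t. f (x + t *\<^sub>R (c u *\<^sub>R u))) has_real_derivative a) (at 0)"
        and b: "((\<lambda>t. f (x + t *\<^sub>R s)) has_real_derivative b) (at 0)"
        and ab: "((\<lambda>t. f (x + t *\<^sub>R (c u *\<^sub>R u + s))) has_real_derivative a + b) (at 0)"
        by auto
      have "((\<lambda>t. f (x + t *\<^sub>R s)) has_real_derivative
         (\<Sum>b\<in>S. c b * deriv (\<lambda>t. f (x + t *\<^sub>R b)) 0)) (at 0)"
        using n unfolding s_def by blast
      then have b': "b = (\<Sum>b\<in>S. c b * deriv (\<lambda>t. f (x + t *\<^sub>R b)) 0)"
        using b DERIV_unique by blast
      obtain d where d: "((\<lambda>t. f (x + t *\<^sub>R u)) has_real_derivative d) (at 0)"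
        using n by (auto simp: real_differentiable_def)
      \<comment> \<open>Homogeneity through the chain rule, which also covers
        \<open>c u = 0\<close>.\<close>
      have "((\<lambda>t. f (x + t *\<^sub>R u)) \<circ> (\<lambda>t. t * c u) has_real_derivative d * c u) (at 0)"
        by (rule DERIV_chain) (use d in \<open>auto intro!: derivative_eq_intros\<close>)
      then have "((\<lambda>t. f (x + t *\<^sub>R (c u *\<^sub>R u))) has_real_derivative d * c u) (at 0)"
        by (simp add: o_def)
      then have "a = d * c u" using a DERIV_unique by blast
      then have "a = c u * deriv (\<lambda>t. f (x + t *\<^sub>R u)) 0" using DERIV_imp_deriv[OF d] by simp
      then have "x \<notin> ?Bad (insert u S)" using ab b' insert.hyps by (simp add: s_def)
      then show False using x by blast
    qed
  qed
  moreover have "negligible (?B1 \<union> ?B2 \<union> ?Bad S)"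
    by (intro negligible_Un insert.IH negligible_not_directional_derivative_add[OF lip]
          negligible_not_directional_differentiable[OF lip])
  ultimately show ?case using negligible_subset by blast
qed

text \<open>Compactness of the unit sphere reduces to finitely many directions of \<open>D\<close>,
  for which the one-dimensional expansions hold with a common radius; the Lipschitz bound pays for
  replacing an arbitrary direction by a nearby one.\<close>

lemma differentiable_if_dense_directional:
  fixes f :: "'a::euclidean_space \<Rightarrow> real"
  assumes lip: "\<And>x y. \<bar>f x - f y\<bar> \<le> L * norm (x - y)"
    and dense: "\<And>X. open X \<Longrightarrow> X \<noteq> {} \<Longrightarrow> \<exists>d\<in>D. d \<in> X"
    and deriv: "\<And>v. v \<in> D \<Longrightarrow> ((\<lambda>t. f (x + t *\<^sub>R v)) has_real_derivative g \<bullet> v) (at 0)"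
  shows "(f has_derivative (\<lambda>h. g \<bullet> h)) (at x)"
  unfolding has_derivative_at_alt
proof (intro conjI allI impI)
  show "bounded_linear (\<lambda>h. g \<bullet> h)" by (rule bounded_linear_inner_right)
  fix e :: real assume "e > 0"
  have L0: "L \<ge> 0"
  proof -
    obtain b :: 'a where "b \<in> Basis" using nonempty_Basis by blast
    then show ?thesis using lip[of b 0] by simp
  qed
  \<comment> \<open>Three errors per unit length: \<open>L * \<eta>\<close> from moving the point,
    \<open>norm g * \<eta>\<close> from moving the direction in the linear part, and \<eta> from the
    directional expansion. They add up to \<open>e\<close>.\<close>
  define \<eta> where "\<eta> = e / (L + norm g + 1)"
  have den: "L + norm g + 1 > 0" using L0 by (smt (verit) norm_ge_zero)
  have \<eta>: "\<eta> > 0" "(L + norm g + 1) * \<eta> = e"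
    using den \<open>e > 0\<close> by (auto simp: \<eta>_def)
  have "sphere 0 1 \<subseteq> (\<Union>v\<in>D. ball v \<eta>)"
  proof
    fix u :: 'a
    obtain d where "d \<in> D" "d \<in> ball u \<eta>" using dense[of "ball u \<eta>"] \<eta>(1) by auto
    then show "u \<in> (\<Union>v\<in>D. ball v \<eta>)" by (auto simp: dist_commute)
  qed
  then obtain C where C: "C \<subseteq> D" "finite C" "sphere 0 1 \<subseteq> (\<Union>v\<in>C. ball v \<eta>)"
    using compactE_image[OF compact_sphere, of D "\<lambda>v. ball v \<eta>" 0 1] by auto
  have "\<forall>v\<in>C. \<forall>\<^sub>F t in at 0. \<bar>f (x + t *\<^sub>R v) - f x - t * (g \<bullet> v)\<bar> \<le> \<eta> * \<bar>t\<bar>"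
  proof
    fix v assume "v \<in> C"
    then have "((\<lambda>t. (f (x + t *\<^sub>R v) - f x) / t) \<longlongrightarrow> g \<bullet> v) (at 0)"
      using deriv[of v] C(1) by (auto simp: DERIV_def)
    then have "\<forall>\<^sub>F t in at 0. dist ((f (x + t *\<^sub>R v) - f x) / t) (g \<bullet> v) < \<eta>"
      using \<eta>(1) tendstoD by blast
    moreover have "\<forall>\<^sub>F t in at (0::real). t \<noteq> 0" by (simp add: eventually_at_filter)
    ultimately show "\<forall>\<^sub>F t in at 0. \<bar>f (x + t *\<^sub>R v) - f x - t * (g \<bullet> v)\<bar> \<le> \<eta> * \<bar>t\<bar>"
    proof eventually_elim
      case (elim t)
      have "f (x + t *\<^sub>R v) - f x - t * (g \<bullet> v) = ((f (x + t *\<^sub>R v) - f x) / t - g \<bullet> v) * t"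
        using elim(2) by (simp add: field_simps)
      then show ?case using elim by (simp add: abs_mult dist_real_def mult_right_mono)
    qed
  qed
  then have "\<forall>\<^sub>F t in at 0. \<forall>v\<in>C. \<bar>f (x + t *\<^sub>R v) - f x - t * (g \<bullet> v)\<bar> \<le> \<eta> * \<bar>t\<bar>"
    using C(2) by (simp add: eventually_ball_finite)
  then obtain d where d: "d > 0"
    "\<And>t v. t \<noteq> 0 \<Longrightarrow> \<bar>t\<bar> < d \<Longrightarrow> v \<in> C \<Longrightarrow> \<bar>f (x + t *\<^sub>R v) - f x - t * (g \<bullet> v)\<bar> \<le> \<eta> * \<bar>t\<bar>"
    unfolding eventually_at by auto
  show "\<exists>d>0. \<forall>y. norm (y - x) < d \<longrightarrow> norm (f y - f x - g \<bullet> (y - x)) \<le> e * norm (y - x)"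
  proof (intro exI[of _ d] conjI allI impI d(1))
    fix y assume y: "norm (y - x) < d"
    show "norm (f y - f x - g \<bullet> (y - x)) \<le> e * norm (y - x)"
    proof (cases "y = x")
      case False
      define t where "t = norm (y - x)"
      define u where "u = (y - x) /\<^sub>R t"
      have t: "t > 0" "t < d" using y False by (auto simp: t_def)
      have yx: "y = x + t *\<^sub>R u" using t by (simp add: u_def)
      have "norm u = 1" using t by (simp add: u_def t_def)
      then obtain v where v: "v \<in> C" "norm (v - u) < \<eta>" using C(3) by (force simp: dist_norm)
      have "\<bar>f y - f (x + t *\<^sub>R v)\<bar> \<le> L * norm (t *\<^sub>R (u - v))"
        using lip[of y "x + t *\<^sub>R v"] by (simp add: yx scaleR_diff_right)
      also have "\<dots> \<le> L * (t * \<eta>)"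
        using v(2) t L0 by (intro mult_left_mono) (auto simp: norm_minus_commute)
      finally have 1: "\<bar>f y - f (x + t *\<^sub>R v)\<bar> \<le> L * (t * \<eta>)" .
      have "\<bar>g \<bullet> (v - u)\<bar> \<le> norm g * norm (v - u)" by (rule Cauchy_Schwarz_ineq2)
      also have "\<dots> \<le> norm g * \<eta>" using v(2) by (intro mult_left_mono) auto
      finally have "t * \<bar>g \<bullet> (v - u)\<bar> \<le> t * (norm g * \<eta>)" using t by (intro mult_left_mono) auto
      then have 2: "\<bar>t * (g \<bullet> v) - g \<bullet> (y - x)\<bar> \<le> t * (norm g * \<eta>)"
        using t by (simp add: yx inner_diff_right abs_mult right_diff_distrib[symmetric])
      have 3: "\<bar>f (x + t *\<^sub>R v) - f x - t * (g \<bullet> v)\<bar> \<le> \<eta> * t"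
        using d(2)[of t v] t v(1) by auto
      have "\<bar>f y - f x - g \<bullet> (y - x)\<bar> \<le> L * (t * \<eta>) + t * (norm g * \<eta>) + \<eta> * t"
        using 1 2 3 by linarith
      also have "\<dots> = ((L + norm g + 1) * \<eta>) * t" by (simp add: algebra_simps)
      finally show ?thesis unfolding \<eta>(2) by (simp add: t_def)
    qed simp
  qed
qed

theorem rademacher_real:
  fixes f :: "'a::euclidean_space \<Rightarrow> real"
  assumes lip: "\<And>x y. \<bar>f x - f y\<bar> \<le> L * norm (x - y)"
  shows "negligible {x. \<not> f differentiable (at x)}"
proof -
  obtain D :: "'a set" where D: "countable D" "\<And>X. open X \<Longrightarrow> X \<noteq> {} \<Longrightarrow> \<exists>d\<in>D. d \<in> X"
    using countable_dense_exists by metis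
  define Bad where "Bad v = {x. \<not> ((\<lambda>t. f (x + t *\<^sub>R (\<Sum>b\<in>Basis. (v \<bullet> b) *\<^sub>R b))) has_real_derivative
     (\<Sum>b\<in>Basis. (v \<bullet> b) * deriv (\<lambda>t. f (x + t *\<^sub>R b)) 0)) (at 0)}" for v
  have "negligible (\<Union>(Bad ` D))"
    using D(1) negligible_not_directional_derivative_sum[OF lip finite_Basis]
    by (intro negligible_countable_Union) (auto simp: Bad_def)
  moreover have "{x. \<not> f differentiable (at x)} \<subseteq> \<Union>(Bad ` D)"
  proof
    fix x assume x: "x \<in> {x. \<not> f differentiable (at x)}"
    show "x \<in> \<Union>(Bad ` D)"
    proof (rule ccontr)
      assume n: "x \<notin> \<Union>(Bad ` D)"
      let ?g = "\<Sum>b\<in>Basis. deriv (\<lambda>t. f (x + t *\<^sub>R b)) 0 *\<^sub>R b"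
      have "((\<lambda>t. f (x + t *\<^sub>R v)) has_real_derivative ?g \<bullet> v) (at 0)" if v: "v \<in> D" for v
      proof -
        have "?g \<bullet> v = (\<Sum>b\<in>Basis. (v \<bullet> b) * deriv (\<lambda>t. f (x + t *\<^sub>R b)) 0)"
          by (simp add: inner_sum_left inner_commute[of v] mult.commute)
        moreover have "x \<notin> Bad v" using n v by blast
        ultimately show ?thesis unfolding Bad_def by (simp add: euclidean_representation)
      qed
      then have "(f has_derivative (\<lambda>h. ?g \<bullet> h)) (at x)"
        using differentiable_if_dense_directional[OF lip D(2)] by blast
      then show False using x differentiable_def by blast
    qed
  qed
  ultimately show ?thesis using negligible_subset by blast
qed

theorem rademacher:
  fixes f :: "'a::euclidean_space \<Rightarrow> 'b::euclidean_space"
  assumes lip: "\<And>x y. norm (f x - f y) \<le> L * norm (x - y)"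
  shows "negligible {x. \<not> f differentiable (at x)}"
proof -
  have "negligible {x. \<not> (\<lambda>x. f x \<bullet> b) differentiable (at x)}" if "b \<in> Basis" for b
  proof (rule rademacher_real)
    show "\<bar>f x \<bullet> b - f y \<bullet> b\<bar> \<le> L * norm (x - y)" for x y
      using order_trans[OF Basis_le_norm[OF that, of "f x - f y"] lip[of x y]] by (simp add: inner_diff_left)
  qed
  then have "negligible (\<Union>b\<in>Basis. {x. \<not> (\<lambda>x. f x \<bullet> b) differentiable (at x)})"
    by (intro negligible_Union) auto
  moreover have "{x. \<not> f differentiable (at x)} \<subseteq> (\<Union>b\<in>Basis. {x. \<not> (\<lambda>x. f x \<bullet> b) differentiable (at x)})"
    using differentiable_componentwise_within[of f _ UNIV] by auto
  ultimately show ?thesis using negligible_subset by blast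
qed

subsection \<open>Second-order differentiability at contact points\<close>

text \<open>A subgradient of convex analysis, with the inequality on the whole space. Having one at
  every point is the form in which convexity is assumed below.\<close>

definition subgradient :: "('a::real_inner \<Rightarrow> real) \<Rightarrow> 'a \<Rightarrow> 'a \<Rightarrow> bool" where
  "subgradient F x \<xi> \<longleftrightarrow> (\<forall>y. F x + \<xi> \<bullet> (y - x) \<le> F y)"

lemma subgradientD: "subgradient F x \<xi> \<Longrightarrow> F x + \<xi> \<bullet> (y - x) \<le> F y"
  by (simp add: subgradient_def)

lemma subgradient_monotone:
  assumes "subgradient F x \<xi>" "subgradient F y \<eta>"
  shows "0 \<le> (\<xi> - \<eta>) \<bullet> (x - y)"
  using subgradientD[OF assms(1), of y] subgradientD[OF assms(2), of x]
  by (simp add: inner_diff_left inner_diff_right)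

lemma continuous_on_if_bounded_subgradients:
  assumes sub: "\<And>x. \<exists>\<xi>. subgradient F x \<xi> \<and> norm \<xi> \<le> L"
  shows "continuous_on A F"
proof -
  have L0: "L \<ge> 0" using sub[of undefined] norm_ge_zero order_trans by blast
  have one: "F y - F x \<le> L * norm (x - y)" for x y
  proof -
    obtain \<eta> where "subgradient F y \<eta>" "norm \<eta> \<le> L" using sub by blast
    then have "F y - F x \<le> - (\<eta> \<bullet> (x - y))" using subgradientD[of F y \<eta> x] by simp
    also have "\<dots> \<le> norm \<eta> * norm (x - y)" using Cauchy_Schwarz_ineq2[of \<eta> "x - y"] by linarith
    also have "\<dots> \<le> L * norm (x - y)" using \<open>norm \<eta> \<le> L\<close> by (simp add: mult_right_mono)
    finally show ?thesis .
  qed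
  have "L-lipschitz_on A F"
  proof (rule lipschitz_onI[OF _ L0])
    show "dist (F x) (F y) \<le> L * dist x y" for x y
      using one[of x y] one[of y x] by (simp add: dist_norm abs_le_iff norm_minus_commute)
  qed
  then show ?thesis by (rule lipschitz_on_continuous_on)
qed

text \<open>The minimizer of \<open>F\<close> plus half the squared distance to \<open>z\<close>
  solves this inclusion: its optimality condition is that \<open>z - x\<close> is a subgradient at
  \<open>x\<close>.\<close>

lemma subgradient_surj:
  fixes F :: "'a::euclidean_space \<Rightarrow> real"
  assumes sub: "\<And>x. \<exists>\<xi>. subgradient F x \<xi> \<and> norm \<xi> \<le> L"
  shows "\<exists>x. subgradient F x (z - x)"
proof -
  define G where "G x = F x + (norm (x - z))\<^sup>2 / 2" for x
  obtain \<xi>z where \<xi>z: "subgradient F z \<xi>z" "norm \<xi>z \<le> L" using sub by blast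
  have L0: "L \<ge> 0" using \<xi>z(2) norm_ge_zero order_trans by blast
  \<comment> \<open>Outside this ball half the squared distance to \<open>z\<close> exceeds the
    greatest possible decrease of \<open>F\<close>, which is \<open>L\<close> times the distance, so
    the minimum over the ball is global.\<close>
  have "continuous_on (cball z (2 * L)) G" unfolding G_def
    by (intro continuous_intros continuous_on_if_bounded_subgradients[OF sub]) auto
  then obtain x where x: "x \<in> cball z (2 * L)" "\<And>y. y \<in> cball z (2 * L) \<Longrightarrow> G x \<le> G y"
    using continuous_attains_inf[OF compact_cball, of z "2 * L" G] L0 by auto
  have min: "G x \<le> G y" for y
  proof (cases "y \<in> cball z (2 * L)")
    case False
    let ?r = "norm (y - z)"
    have r: "?r > 2 * L" using False by (simp add: dist_norm norm_minus_commute)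
    have "F y \<ge> F z + \<xi>z \<bullet> (y - z)" using subgradientD[OF \<xi>z(1)] .
    moreover have "\<bar>\<xi>z \<bullet> (y - z)\<bar> \<le> L * ?r"
      using order_trans[OF Cauchy_Schwarz_ineq2 mult_right_mono[OF \<xi>z(2)]] by simp
    moreover have "L * ?r \<le> ?r\<^sup>2 / 2"
      using mult_right_mono[of "2 * L" ?r ?r] r by (simp add: power2_eq_square)
    ultimately have "G z \<le> G y" unfolding G_def by simp
    then show ?thesis using x(2)[of z] L0 by simp
  qed (use x in auto)
  have "subgradient F x (z - x)" unfolding subgradient_def
  proof
    fix y
    let ?w = "y - x"
    \<comment> \<open>Compare the minimizer with a point on the segment to \<open>y\<close>;
      convexity and division by \<open>t\<close> leave an error of order \<open>t\<close>.\<close>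
    have "F x + (z - x) \<bullet> ?w \<le> F y + t * ((norm ?w)\<^sup>2 / 2)" if t: "0 < t" "t < 1" for t
    proof -
      obtain \<mu> where \<mu>: "subgradient F (x + t *\<^sub>R ?w) \<mu>" using sub by blast
      have "F (x + t *\<^sub>R ?w) \<le> F x + t * (\<mu> \<bullet> ?w)"
        using subgradientD[OF \<mu>, of x] by simp
      then have a: "(1 - t) * F (x + t *\<^sub>R ?w) \<le> (1 - t) * (F x + t * (\<mu> \<bullet> ?w))"
        using t by (intro mult_left_mono) auto
      have "F (x + t *\<^sub>R ?w) + (1 - t) * (\<mu> \<bullet> ?w) \<le> F y"
        using subgradientD[OF \<mu>, of y]
        by (simp add: inner_diff_right inner_add_right algebra_simps)
      then have b: "t * (F (x + t *\<^sub>R ?w) + (1 - t) * (\<mu> \<bullet> ?w)) \<le> t * F y"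
        using t by (intro mult_left_mono) auto
      have conv: "F (x + t *\<^sub>R ?w) \<le> (1 - t) * F x + t * F y"
        using a b by (simp add: algebra_simps)
      have sq: "(norm (x + t *\<^sub>R ?w - z))\<^sup>2 = (norm (x - z))\<^sup>2 - 2 * t * ((z - x) \<bullet> ?w) + t\<^sup>2 * (norm ?w)\<^sup>2"
      proof -
        have "x + t *\<^sub>R ?w - z = (x - z) + t *\<^sub>R ?w" by simp
        then show ?thesis
          unfolding power2_norm_eq_inner
          by (simp add: inner_add_left inner_add_right inner_diff_left inner_diff_right inner_commute algebra_simps power2_eq_square)
      qed
      have "t * (F x + (z - x) \<bullet> ?w) \<le> t * (F y + t * ((norm ?w)\<^sup>2 / 2))"
        using min[of "x + t *\<^sub>R ?w"] conv unfolding G_def sq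
        by (simp add: field_simps power2_eq_square)
      then show ?thesis using t by simp
    qed
    then have "\<forall>\<^sub>F t in at_right 0. F x + (z - x) \<bullet> ?w \<le> F y + t * ((norm ?w)\<^sup>2 / 2)"
      by (auto simp: eventually_at_right_field intro!: exI[of _ 1])
    moreover have "((\<lambda>t. F y + t * ((norm ?w)\<^sup>2 / 2)) \<longlongrightarrow> F y + 0 * ((norm ?w)\<^sup>2 / 2)) (at_right 0)"
      by (intro tendsto_intros)
    ultimately show "F x + (z - x) \<bullet> ?w \<le> F y"
      using tendsto_lowerbound by fastforce
  qed
  then show ?thesis by blast
qed

text \<open>
  Minty's parametrization: the inverse \<open>J\<close> of the identity plus the subdifferential is a nonexpansive
  map defined everywhere, so Rademacher's theorem applies to it.
\<close>
lemma proximal_map_exists: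
  fixes F :: "'a::euclidean_space \<Rightarrow> real"
  assumes sub: "\<And>x. \<exists>\<xi>. subgradient F x \<xi> \<and> norm \<xi> \<le> L"
  obtains J where "\<And>z. subgradient F (J z) (z - J z)"
    "\<And>x \<xi>. subgradient F x \<xi> \<Longrightarrow> J (x + \<xi>) = x"
    "\<And>z z'. norm (J z - J z') \<le> norm (z - z')"
proof -
  define J where "J z = (SOME x. subgradient F x (z - x))" for z
  have J: "subgradient F (J z) (z - J z)" for z
    unfolding J_def using subgradient_surj[OF sub] by (rule someI_ex)
  have nonexp: "norm (x - x') \<le> norm (z - z')"
    if "subgradient F x (z - x)" "subgradient F x' (z' - x')" for x x' z z'
  proof -
    have "(norm (x - x'))\<^sup>2 \<le> (z - z') \<bullet> (x - x')"
      using subgradient_monotone[OF that] by (simp add: power2_norm_eq_inner inner_diff_left inner_diff_right inner_commute)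
    also have "\<dots> \<le> norm (z - z') * norm (x - x')" by (rule norm_cauchy_schwarz)
    finally have "norm (x - x') * norm (x - x') \<le> norm (z - z') * norm (x - x')"
      by (simp add: power2_eq_square)
    then show ?thesis by (metis mult_right_le_imp_le norm_ge_zero order_le_less)
  qed
  have "J (x + \<xi>) = x" if "subgradient F x \<xi>" for x \<xi>
    using nonexp[OF J[of "x + \<xi>"], of x "x + \<xi>"] that by simp
  then show thesis using that J nonexp[OF J J] by blast
qed

text \<open>Apply the subgradient inequality at \<open>y\<close> to a step of length
  \<open>norm (y - x)\<close> in the direction of \<open>\<eta> - \<xi>\<close>. It ends within
  \<open>2 * norm (y - x) < r\<close> of \<open>x\<close>, where the upper bound allows a growth of
  \<open>C\<close> times the square of that distance: hence the 4 and the radius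
  \<open>r / 2\<close>.\<close>

lemma subgradient_calmness:
  fixes F :: "'a::euclidean_space \<Rightarrow> real"
  assumes upper: "\<And>y. y \<in> ball x r \<Longrightarrow> F y \<le> F x + \<xi> \<bullet> (y - x) + C * (norm (y - x))\<^sup>2"
    and "C \<ge> 0" and x: "subgradient F x \<xi>" and y: "subgradient F y \<eta>" "norm (y - x) < r / 2"
  shows "norm (\<eta> - \<xi>) \<le> 4 * C * norm (y - x)"
proof (cases "y = x \<or> \<eta> = \<xi>")
  case False
  define \<rho> where "\<rho> = norm (y - x)"
  define v where "v = (\<rho> / norm (\<eta> - \<xi>)) *\<^sub>R (\<eta> - \<xi>)"
  have \<rho>: "\<rho> > 0" using False by (simp add: \<rho>_def)
  have nv: "norm v = \<rho>" using False \<rho> by (simp add: v_def)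
  have "norm (y + v - x) \<le> norm (y - x) + norm v"
    by (metis add_diff_eq add.commute norm_triangle_ineq)
  then have n2: "norm (y + v - x) \<le> 2 * \<rho>" using nv by (simp add: \<rho>_def)
  then have "y + v \<in> ball x r" using y(2) by (simp add: dist_norm norm_minus_commute \<rho>_def)
  then have "F (y + v) \<le> F x + \<xi> \<bullet> (y + v - x) + C * (norm (y + v - x))\<^sup>2" by (rule upper)
  also have "C * (norm (y + v - x))\<^sup>2 \<le> C * (2 * \<rho>)\<^sup>2"
    using n2 \<open>C \<ge> 0\<close> by (intro mult_left_mono power_mono) auto
  finally have "F (y + v) \<le> F x + \<xi> \<bullet> (y + v - x) + C * (2 * \<rho>)\<^sup>2" by simp
  moreover have "F y + \<eta> \<bullet> v \<le> F (y + v)" using subgradientD[OF y(1), of "y + v"] by simp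
  moreover have "F x + \<xi> \<bullet> (y - x) \<le> F y" using subgradientD[OF x] .
  ultimately have "(\<eta> - \<xi>) \<bullet> v \<le> 4 * C * \<rho> * \<rho>"
    by (simp add: inner_diff_left inner_diff_right inner_add_right power2_eq_square)
  moreover have "(\<eta> - \<xi>) \<bullet> v = norm (\<eta> - \<xi>) * \<rho>"
    using False by (simp add: v_def dot_square_norm power2_eq_square)
  ultimately have "norm (\<eta> - \<xi>) \<le> 4 * C * \<rho>" using \<rho> by simp
  then show ?thesis by (simp add: \<rho>_def)
next
  case True
  then show ?thesis
  proof
    \<comment> \<open>For \<open>y = x\<close> the claim is uniqueness of the subgradient. The step
      length above would be 0, so a free step \<open>t\<close> is used, short enough to stay in the
      ball and to have \<open>t * C < 1\<close>.\<close>
    assume yx: "y = x"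
    show ?thesis
    proof (rule ccontr)
      assume "\<not> ?thesis"
      then have ne: "\<eta> \<noteq> \<xi>" using yx by auto
      define d where "d = \<eta> - \<xi>"
      have r: "r > 0" using y(2) yx by simp
      have d: "norm d > 0" using ne by (simp add: d_def)
      define t where "t = min (r / (2 * norm d)) (1 / (2 * (C + 1)))"
      have t: "t > 0" "t * norm d < r" "t * C < 1"
      proof -
        show "t > 0" using r d \<open>C \<ge> 0\<close> by (simp add: t_def)
        have "t * norm d \<le> (r / (2 * norm d)) * norm d" using d by (intro mult_right_mono) (auto simp: t_def)
        then show "t * norm d < r" using r d by simp
        have "t * C \<le> (1 / (2 * (C + 1))) * C" using \<open>C \<ge> 0\<close> by (intro mult_right_mono) (auto simp: t_def)
        also have "\<dots> < 1" using \<open>C \<ge> 0\<close> by (simp add: field_simps)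
        finally show "t * C < 1" .
      qed
      have "x + t *\<^sub>R d \<in> ball x r" using t by (simp add: dist_norm)
      from upper[OF this] have "F (x + t *\<^sub>R d) \<le> F x + t * (\<xi> \<bullet> d) + C * (t\<^sup>2 * (norm d)\<^sup>2)"
        using t by (simp add: power_mult_distrib)
      moreover have "F x + t * (\<eta> \<bullet> d) \<le> F (x + t *\<^sub>R d)"
        using subgradientD[OF y(1), of "x + t *\<^sub>R d"] yx by simp
      ultimately have "t * (d \<bullet> d) \<le> C * (t\<^sup>2 * (norm d)\<^sup>2)"
        by (simp add: d_def inner_diff_left algebra_simps)
      then have "t * (norm d)\<^sup>2 * 1 \<le> t * (norm d)\<^sup>2 * (t * C)"
        by (simp add: dot_square_norm power2_eq_square mult_ac)
      then have "1 \<le> t * C" using t d by (simp del: mult_1_right)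
      then show False using t by simp
    qed
  qed (use \<open>C \<ge> 0\<close> in simp)
qed

text \<open>The subdifferential is the inverse of \<open>J\<close> minus the identity, so its
  derivative should be the inverse of that of \<open>J\<close>, minus the identity. \<open>J\<close>
  alone may have a singular derivative; the upper quadratic bound excludes this, since by calmness
  \<open>norm (z' - z)\<close> is at most \<open>1 + 4 * C\<close> times
  \<open>norm (J z' - J z)\<close> near \<open>z\<close>.\<close>

lemma subgradient_differentiable_at_contact:
  fixes F :: "'a::euclidean_space \<Rightarrow> real"
  assumes J: "\<And>z. subgradient F (J z) (z - J z)"
    "\<And>x \<xi>. subgradient F x \<xi> \<Longrightarrow> J (x + \<xi>) = x"
    "\<And>z z'. norm (J z - J z') \<le> norm (z - z')"
    and diff: "J differentiable (at (x + \<xi>))" and x: "subgradient F x \<xi>"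
    and upper: "\<And>y. y \<in> ball x r \<Longrightarrow> F y \<le> F x + \<xi> \<bullet> (y - x) + C * (norm (y - x))\<^sup>2"
    and "C \<ge> 0" and "r > 0"
  shows "\<exists>S. linear S \<and> (\<forall>e>0. \<exists>d>0. \<forall>y \<eta>. subgradient F y \<eta> \<and> norm (y - x) < d \<longrightarrow>
           norm (\<eta> - \<xi> - S (y - x)) \<le> e * norm (y - x))"
proof -
  define z where "z = x + \<xi>"
  have Jz: "J z = x" using J(2)[OF x] by (simp add: z_def)
  obtain T where T: "(J has_derivative T) (at z)" using diff by (auto simp: z_def differentiable_def)
  then have linT: "linear T" using has_derivative_linear by blast
  have Tsmall: "\<exists>d>0. \<forall>z'. norm (z' - z) < d \<longrightarrow> norm (J z' - x - T (z' - z)) \<le> e * norm (z' - z)"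
    if "e > 0" for e
    using T that Jz unfolding has_derivative_at_alt by auto
  let ?K = "1 + 4 * C"
  have K: "?K > 0" using \<open>C \<ge> 0\<close> by simp
  have calm: "norm (y + \<eta> - z) \<le> ?K * norm (y - x)"
    if "subgradient F y \<eta>" "norm (y - x) < r / 2" for y \<eta>
  proof -
    have "y + \<eta> - z = (y - x) + (\<eta> - \<xi>)" by (simp add: z_def)
    then have "norm (y + \<eta> - z) \<le> norm (y - x) + norm (\<eta> - \<xi>)" by (metis norm_triangle_ineq)
    then show ?thesis
      using subgradient_calmness[OF upper \<open>C \<ge> 0\<close> x that] by (simp add: algebra_simps)
  qed
  have "inj T"
  proof (subst linear_injective_0[OF linT], intro allI impI, rule ccontr)
    fix v assume Tv: "T v = 0" and v: "v \<noteq> 0"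
    obtain d where d: "d > 0"
      "\<And>z'. norm (z' - z) < d \<Longrightarrow> norm (J z' - x - T (z' - z)) \<le> 1 / (2 * ?K) * norm (z' - z)"
      using Tsmall[of "1 / (2 * ?K)"] K by auto
    define t where "t = min d (r / 2) / (2 * norm v)"
    have t: "t > 0" using d(1) \<open>r > 0\<close> v by (simp add: t_def)
    define z' where "z' = z + t *\<^sub>R v"
    have nz: "norm (z' - z) = min d (r / 2) / 2" using v t d(1) \<open>r > 0\<close> by (simp add: z'_def t_def)
    have "norm (J z' - x) \<le> norm (z' - z)" using J(3)[of z' z] by (simp add: Jz)
    also have "\<dots> < r / 2" using nz d(1) \<open>r > 0\<close> by linarith
    finally have "norm (z' - z) \<le> ?K * norm (J z' - x)" using calm[OF J(1)[of z']] by simp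
    moreover have "norm (J z' - x) \<le> 1 / (2 * ?K) * norm (z' - z)"
      using d(2)[of z'] nz d(1) \<open>r > 0\<close> Tv linear_scale[OF linT, of t v] by (simp add: z'_def)
    ultimately have "norm (z' - z) \<le> ?K * (1 / (2 * ?K) * norm (z' - z))"
      using K by (meson order_trans mult_left_mono less_imp_le)
    also have "\<dots> = norm (z' - z) / 2" using K by (simp add: field_simps)
    finally have "norm (z' - z) \<le> norm (z' - z) / 2" .
    moreover have "norm (z' - z) > 0" unfolding nz using d(1) \<open>r > 0\<close> by simp
    ultimately show False by simp
  qed
  then obtain R where R: "linear R" "R \<circ> T = id"
    using linear_injective_left_inverse[OF linT] by blast
  obtain B where B: "B > 0" "\<And>w. norm (R w) \<le> B * norm w" using linear_bounded_pos[OF R(1)] by blast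
  define S where "S w = R w - w" for w
  have "linear S" unfolding S_def using R(1) by (intro linear_compose_sub linear_id[unfolded id_def])
  moreover have "\<exists>d>0. \<forall>y \<eta>. subgradient F y \<eta> \<and> norm (y - x) < d \<longrightarrow>
           norm (\<eta> - \<xi> - S (y - x)) \<le> e * norm (y - x)" if "e > 0" for e
  proof -
    \<comment> \<open>\<open>?K\<close> bounds the increment of the parameter \<open>z\<close> by
      that of \<open>x\<close>, and \<open>B\<close> bounds the left inverse
      \<open>R\<close>.\<close>
    define e' where "e' = e / (B * ?K)"
    have e': "e' > 0" "B * e' * ?K = e" using \<open>e > 0\<close> B(1) K by (simp_all add: e'_def)
    obtain d where d: "d > 0" "\<And>z'. norm (z' - z) < d \<Longrightarrow> norm (J z' - x - T (z' - z)) \<le> e' * norm (z' - z)"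
      using Tsmall[OF e'(1)] by blast
    show ?thesis
    proof (intro exI[of _ "min (d / ?K) (r / 2)"] conjI allI impI)
      show "min (d / ?K) (r / 2) > 0" using d(1) K \<open>r > 0\<close> by simp
      fix y \<eta> assume y: "subgradient F y \<eta> \<and> norm (y - x) < min (d / ?K) (r / 2)"
      define z' where "z' = y + \<eta>"
      have Jz': "J z' = y" using J(2) y by (simp add: z'_def)
      have c: "norm (z' - z) \<le> ?K * norm (y - x)" using calm[of y \<eta>] y by (simp add: z'_def)
      also have "\<dots> < d" using y K by (simp add: field_simps)
      finally have er: "norm (y - x - T (z' - z)) \<le> e' * norm (z' - z)" using d(2) Jz' by blast
      have "R (y - x - T (z' - z)) = R (y - x) - (z' - z)"
        using linear_diff[OF R(1)] R(2) by (metis comp_apply id_apply)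
      then have "\<eta> - \<xi> - S (y - x) = - R (y - x - T (z' - z))"
        by (simp add: S_def z'_def z_def)
      then have "norm (\<eta> - \<xi> - S (y - x)) = norm (R (y - x - T (z' - z)))" by (simp add: norm_minus_cancel)
      also have "\<dots> \<le> B * norm (y - x - T (z' - z))" by (rule B(2))
      also have "\<dots> \<le> B * (e' * (?K * norm (y - x)))"
        using er c B(1) e'(1) by (intro mult_left_mono) (auto intro: order_trans mult_left_mono)
      also have "\<dots> = e * norm (y - x)" using e'(2) by (simp add: mult_ac)
      finally show "norm (\<eta> - \<xi> - S (y - x)) \<le> e * norm (y - x)" .
    qed
  qed
  ultimately show ?thesis by blast
qed

text \<open>Cut the unit interval into \<open>n + 1\<close> equal pieces: the quadratic defects add
  up to \<open>K / (n + 1)\<close> and vanish in the limit. This stands in for integrating a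
  derivative.\<close>

lemma increment_le_if_quadratic_defect:
  fixes g :: "real \<Rightarrow> real"
  assumes step: "\<And>s t. 0 \<le> s \<Longrightarrow> s < t \<Longrightarrow> t \<le> 1 \<Longrightarrow> g t - g s \<le> e * (t - s) + K * (t - s)\<^sup>2"
  shows "g 1 - g 0 \<le> e"
proof -
  have bound: "g 1 - g 0 \<le> e + K * inverse (real (Suc n))" for n
  proof -
    let ?N = "real (Suc n)"
    have "g 1 - g 0 = (\<Sum>i<Suc n. g (real (Suc i) / ?N) - g (real i / ?N))"
      using sum_lessThan_telescope[of "\<lambda>i. g (real i / ?N)" "Suc n"] by (simp del: of_nat_Suc sum.lessThan_Suc)
    also have "\<dots> \<le> (\<Sum>i<Suc n. e * (1 / ?N) + K * (1 / ?N)\<^sup>2)"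
    proof (rule sum_mono)
      fix i assume "i \<in> {..<Suc n}"
      then have "real (Suc i) / ?N \<le> 1" by (simp del: of_nat_Suc)
      moreover have "real i / ?N < real (Suc i) / ?N" by (simp add: divide_strict_right_mono)
      moreover have "real (Suc i) / ?N - real i / ?N = 1 / ?N" by (simp add: diff_divide_distrib[symmetric])
      ultimately show "g (real (Suc i) / ?N) - g (real i / ?N) \<le> e * (1 / ?N) + K * (1 / ?N)\<^sup>2"
        using step[of "real i / ?N" "real (Suc i) / ?N"] by (simp del: of_nat_Suc)
    qed
    also have "\<dots> = ?N * (e * (1 / ?N) + K * (1 / ?N)\<^sup>2)" by simp
    also have "\<dots> = e + K * inverse ?N" by (simp add: field_simps power2_eq_square del: of_nat_Suc)
    finally show ?thesis .
  qed
  have "(\<lambda>n. e + K * inverse (real (Suc n))) \<longlonglongrightarrow> e + K * 0"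
    by (intro tendsto_intros LIMSEQ_inverse_real_of_nat)
  then show ?thesis using bound by (intro LIMSEQ_le_const) auto
qed

text \<open>Each increment of \<open>\<phi>\<close> is squeezed between the step times the values of
  \<open>m\<close> at the two ends, so \<open>\<phi> 1 - \<phi> 0\<close> behaves like the integral
  of \<open>a + s * b\<close>, which is \<open>a + b / 2\<close>. The selection \<open>m\<close> may
  be arbitrary; no integral of it is formed.\<close>

lemma subgradient_line_expansion:
  fixes \<phi> m :: "real \<Rightarrow> real"
  assumes sub: "\<And>s t. 0 \<le> s \<Longrightarrow> s \<le> 1 \<Longrightarrow> 0 \<le> t \<Longrightarrow> t \<le> 1 \<Longrightarrow> \<phi> s + m s * (t - s) \<le> \<phi> t"
    and m: "\<And>s. 0 \<le> s \<Longrightarrow> s \<le> 1 \<Longrightarrow> \<bar>m s - (a + s * b)\<bar> \<le> e"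
  shows "\<bar>\<phi> 1 - \<phi> 0 - a - b / 2\<bar> \<le> e"
proof -
  define g where "g s = \<phi> s - a * s - b * s\<^sup>2 / 2" for s
  have up: "g t - g s \<le> e * (t - s) + \<bar>b\<bar> * (t - s)\<^sup>2"
    and lo: "- g t - - g s \<le> e * (t - s) + \<bar>b\<bar> * (t - s)\<^sup>2"
    if st: "0 \<le> s" "s < t" "t \<le> 1" for s t
  proof -
    have b2: "\<bar>b * (t - s)\<^sup>2 / 2\<bar> \<le> \<bar>b\<bar> * (t - s)\<^sup>2" by (simp add: abs_mult)
    have "\<phi> t - \<phi> s \<le> m t * (t - s)" using sub[of t s] st by (simp add: algebra_simps)
    also have "\<dots> \<le> (a + t * b + e) * (t - s)"
      using m[of t] st by (intro mult_right_mono) (auto simp: abs_le_iff)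
    finally have "g t - g s \<le> e * (t - s) + b * (t - s)\<^sup>2 / 2"
      by (simp add: g_def power2_eq_square field_simps)
    then show "g t - g s \<le> e * (t - s) + \<bar>b\<bar> * (t - s)\<^sup>2" using b2 by linarith
    have "(a + s * b - e) * (t - s) \<le> m s * (t - s)"
      using m[of s] st by (intro mult_right_mono) (auto simp: abs_le_iff)
    also have "\<dots> \<le> \<phi> t - \<phi> s" using sub[of s t] st by simp
    finally have "- g t - - g s \<le> e * (t - s) + b * (t - s)\<^sup>2 / 2"
      by (simp add: g_def power2_eq_square field_simps)
    then show "- g t - - g s \<le> e * (t - s) + \<bar>b\<bar> * (t - s)\<^sup>2" using b2 by linarith
  qed
  have "g 1 - g 0 \<le> e" by (rule increment_le_if_quadratic_defect[OF up])
  moreover have "- g 1 - - g 0 \<le> e"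
    by (rule increment_le_if_quadratic_defect[where g = "\<lambda>s. - g s", OF lo])
  ultimately show ?thesis by (simp add: g_def abs_le_iff)
qed

text \<open>The expansion sees only the quadratic form of \<open>S\<close>, hence determines
  \<open>S\<close> up to an antisymmetric part; symmetrization comes later.\<close>

definition second_order_at :: "('a::real_inner \<Rightarrow> real) \<Rightarrow> 'a \<Rightarrow> 'a \<Rightarrow> ('a \<Rightarrow> 'a) \<Rightarrow> bool" where
  "second_order_at F x \<xi> S \<longleftrightarrow> linear S \<and>
     (\<forall>e>0. \<exists>d>0. \<forall>h. norm h < d \<longrightarrow> \<bar>F (x + h) - F x - \<xi> \<bullet> h - (h \<bullet> S h) / 2\<bar> \<le> e * (norm h)\<^sup>2)"

lemma second_order_at_if_subgradient_differentiable:
  fixes F :: "'a::real_inner \<Rightarrow> real"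
  assumes ex: "\<And>y. \<exists>\<eta>. subgradient F y \<eta>" and S: "linear S"
    and diff: "\<And>e. e > 0 \<Longrightarrow> \<exists>d>0. \<forall>y \<eta>. subgradient F y \<eta> \<and> norm (y - x) < d \<longrightarrow>
           norm (\<eta> - \<xi> - S (y - x)) \<le> e * norm (y - x)"
  shows "second_order_at F x \<xi> S"
  unfolding second_order_at_def
proof (intro conjI S allI impI)
  fix e :: real assume "e > 0"
  then obtain d where d: "d > 0" "\<And>y \<eta>. subgradient F y \<eta> \<Longrightarrow> norm (y - x) < d \<Longrightarrow>
           norm (\<eta> - \<xi> - S (y - x)) \<le> e * norm (y - x)"
    using diff by blast
  obtain \<eta> where \<eta>: "\<And>y. subgradient F y (\<eta> y)" using ex by metis
  have "\<bar>F (x + h) - F x - \<xi> \<bullet> h - (h \<bullet> S h) / 2\<bar> \<le> e * (norm h)\<^sup>2" if h: "norm h < d" for h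
  proof -
    let ?m = "\<lambda>s. \<eta> (x + s *\<^sub>R h) \<bullet> h"
    have sub: "F (x + s *\<^sub>R h) + ?m s * (t - s) \<le> F (x + t *\<^sub>R h)" for s t
      using subgradientD[OF \<eta>, of "x + s *\<^sub>R h" "x + t *\<^sub>R h"]
      by (simp add: scaleR_diff_left[symmetric] mult.commute)
    have m: "\<bar>?m s - (\<xi> \<bullet> h + s * (h \<bullet> S h))\<bar> \<le> e * (norm h)\<^sup>2" if s: "0 \<le> s" "s \<le> 1" for s
    proof -
      have n: "norm (s *\<^sub>R h) \<le> norm h" using s by (simp add: mult_left_le_one_le)
      then have "norm (\<eta> (x + s *\<^sub>R h) - \<xi> - S (s *\<^sub>R h)) \<le> e * norm (s *\<^sub>R h)"
        using d(2)[OF \<eta>, of "x + s *\<^sub>R h"] h by simp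
      also have "\<dots> \<le> e * norm h" using n \<open>e > 0\<close> by (intro mult_left_mono) auto
      finally have b: "norm (\<eta> (x + s *\<^sub>R h) - \<xi> - S (s *\<^sub>R h)) \<le> e * norm h" .
      have "?m s - (\<xi> \<bullet> h + s * (h \<bullet> S h)) = (\<eta> (x + s *\<^sub>R h) - \<xi> - S (s *\<^sub>R h)) \<bullet> h"
        by (simp add: inner_diff_left linear_scale[OF S] inner_commute[of "S h" h])
      also have "\<bar>\<dots>\<bar> \<le> norm (\<eta> (x + s *\<^sub>R h) - \<xi> - S (s *\<^sub>R h)) * norm h" by (rule Cauchy_Schwarz_ineq2)
      also have "\<dots> \<le> e * norm h * norm h" using b by (intro mult_right_mono) auto
      finally show ?thesis by (simp add: power2_eq_square mult.assoc)
    qed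
    show ?thesis
      using subgradient_line_expansion[of "\<lambda>s. F (x + s *\<^sub>R h)" ?m "\<xi> \<bullet> h" "h \<bullet> S h" "e * (norm h)\<^sup>2"] sub m
      by simp
  qed
  then show "\<exists>d>0. \<forall>h. norm h < d \<longrightarrow> \<bar>F (x + h) - F x - \<xi> \<bullet> h - (h \<bullet> S h) / 2\<bar> \<le> e * (norm h)\<^sup>2"
    using d(1) by blast
qed

text \<open>An exceptional \<open>x\<close> with subgradient \<xi> is the image under
  \<open>J\<close> of \<open>x + \<xi>\<close>, where \<open>J\<close> fails to be differentiable.
  Such parameters form a null set by Rademacher's theorem, and the nonexpansive \<open>J\<close>
  keeps it null. The quadratic bound from above removes the critical values of \<open>J\<close>,
  which a statement at almost every point would have to treat as well.\<close>

theorem alexandrov_at_contact_points: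
  fixes F :: "'a::euclidean_space \<Rightarrow> real"
  assumes sub: "\<And>x. \<exists>\<xi>. subgradient F x \<xi> \<and> norm \<xi> \<le> L"
  shows "negligible {x. \<exists>\<xi> C r. subgradient F x \<xi> \<and> 0 \<le> C \<and> 0 < r \<and>
      (\<forall>y\<in>ball x r. F y \<le> F x + \<xi> \<bullet> (y - x) + C * (norm (y - x))\<^sup>2) \<and>
      \<not> (\<exists>S. second_order_at F x \<xi> S)}" (is "negligible ?N")
proof -
  obtain J where J: "\<And>z. subgradient F (J z) (z - J z)"
    "\<And>x \<xi>. subgradient F x \<xi> \<Longrightarrow> J (x + \<xi>) = x"
    "\<And>z z'. norm (J z - J z') \<le> norm (z - z')"
    using proximal_map_exists[OF sub] by blast
  have "negligible (J ` {z. \<not> J differentiable (at z)})"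
  proof (rule negligible_locally_Lipschitz_image)
    show "negligible {z. \<not> J differentiable (at z)}" by (rule rademacher[of J 1]) (simp add: J(3))
    show "\<exists>T B. open T \<and> x \<in> T \<and> (\<forall>y\<in>{z. \<not> J differentiable (at z)} \<inter> T. norm (J y - J x) \<le> B * norm (y - x))" for x
      using J(3) by (intro exI[of _ UNIV] exI[of _ 1]) auto
  qed simp
  moreover have "?N \<subseteq> J ` {z. \<not> J differentiable (at z)}"
  proof
    fix x assume "x \<in> ?N"
    then obtain \<xi> and C r :: real where x: "subgradient F x \<xi>" and "0 \<le> C" "0 < r"
      and up: "\<And>y. y \<in> ball x r \<Longrightarrow> F y \<le> F x + \<xi> \<bullet> (y - x) + C * (norm (y - x))\<^sup>2"
      and no: "\<not> (\<exists>S. second_order_at F x \<xi> S)" by blast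
    have "\<not> J differentiable (at (x + \<xi>))"
    proof
      assume "J differentiable (at (x + \<xi>))"
      then obtain S where "linear S" "\<And>e. e > 0 \<Longrightarrow> \<exists>d>0. \<forall>y \<eta>. subgradient F y \<eta> \<and> norm (y - x) < d \<longrightarrow>
             norm (\<eta> - \<xi> - S (y - x)) \<le> e * norm (y - x)"
        using subgradient_differentiable_at_contact[OF J _ x up \<open>0 \<le> C\<close> \<open>0 < r\<close>] by blast
      moreover have "\<exists>\<eta>. subgradient F y \<eta>" for y using sub by blast
      ultimately show False
        using no second_order_at_if_subgradient_differentiable by blast
    qed
    then show "x \<in> J ` {z. \<not> J differentiable (at z)}"
      using J(2)[OF x] by (intro image_eqI[of _ _ "x + \<xi>"]) auto
  qed
  ultimately show ?thesis using negligible_subset by blast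
qed

subsection \<open>Jensen's lemma and sup-convolutions\<close>

lemma le_zero_if_le_small_multiples:
  fixes a b :: real
  assumes "\<And>e. e > 0 \<Longrightarrow> a \<le> e * b"
  shows "a \<le> 0"
proof (rule ccontr)
  assume "\<not> a \<le> 0"
  then have a: "a > 0" by simp
  have "a \<le> (a / (2 * (\<bar>b\<bar> + 1))) * b" using a by (intro assms) simp
  also have "\<dots> \<le> (a / (2 * (\<bar>b\<bar> + 1))) * (\<bar>b\<bar> + 1)" using a by (intro mult_left_mono) auto
  also have "\<dots> = a / 2" by (simp add: field_simps)
  finally show False using a by simp
qed

lemma second_order_sum_le:
  assumes F: "second_order_at F x \<xi> S" and G: "second_order_at G x \<eta> T" and "r > 0"
    and up: "\<And>y. y \<in> ball x r \<Longrightarrow> F y + G y \<le> F x + G x + (\<xi> + \<eta>) \<bullet> (y - x) + \<kappa> / 2 * (norm (y - x))\<^sup>2"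
  shows "h \<bullet> S h + h \<bullet> T h \<le> \<kappa> * (norm h)\<^sup>2"
proof -
  have "h \<bullet> S h + h \<bullet> T h - \<kappa> * (norm h)\<^sup>2 \<le> e * (4 * (norm h)\<^sup>2)" if e: "e > 0" for e
  proof -
    obtain d1 where d1: "d1 > 0" "\<And>h. norm h < d1 \<Longrightarrow> \<bar>F (x + h) - F x - \<xi> \<bullet> h - (h \<bullet> S h) / 2\<bar> \<le> e * (norm h)\<^sup>2"
      using F e unfolding second_order_at_def by blast
    obtain d2 where d2: "d2 > 0" "\<And>h. norm h < d2 \<Longrightarrow> \<bar>G (x + h) - G x - \<eta> \<bullet> h - (h \<bullet> T h) / 2\<bar> \<le> e * (norm h)\<^sup>2"
      using G e unfolding second_order_at_def by blast
    define m where "m = min (min d1 d2) r"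
    have m: "m > 0" "m \<le> d1" "m \<le> d2" "m \<le> r" using d1(1) d2(1) \<open>r > 0\<close> by (auto simp: m_def)
    define t where "t = m / (2 * (norm h + 1))"
    have nh: "norm h + 1 > 0" by (simp add: add_nonneg_pos)
    have t: "t > 0" using m(1) nh by (simp add: t_def)
    have "norm (t *\<^sub>R h) \<le> t * (norm h + 1)" using t by simp
    also have "\<dots> < m" using nh m(1) by (simp add: t_def divide_less_eq)
    finally have n: "norm (t *\<^sub>R h) < d1" "norm (t *\<^sub>R h) < d2" "norm (t *\<^sub>R h) < r" using m by auto
    have linS: "linear S" and linT: "linear T" using F G by (auto simp: second_order_at_def)
    have sq: "(norm (t *\<^sub>R h))\<^sup>2 = t\<^sup>2 * (norm h)\<^sup>2" by (simp add: power_mult_distrib)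
    have quad: "(t *\<^sub>R h) \<bullet> S (t *\<^sub>R h) = t\<^sup>2 * (h \<bullet> S h)" "(t *\<^sub>R h) \<bullet> T (t *\<^sub>R h) = t\<^sup>2 * (h \<bullet> T h)"
      by (simp_all add: linear_scale[OF linS] linear_scale[OF linT] power2_eq_square)
    have 1: "\<bar>F (x + t *\<^sub>R h) - F x - t * (\<xi> \<bullet> h) - t\<^sup>2 * (h \<bullet> S h) / 2\<bar> \<le> e * (t\<^sup>2 * (norm h)\<^sup>2)"
      using d1(2)[OF n(1)] unfolding sq quad inner_scaleR_right .
    have 2: "\<bar>G (x + t *\<^sub>R h) - G x - t * (\<eta> \<bullet> h) - t\<^sup>2 * (h \<bullet> T h) / 2\<bar> \<le> e * (t\<^sup>2 * (norm h)\<^sup>2)"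
      using d2(2)[OF n(2)] unfolding sq quad inner_scaleR_right .
    have "x + t *\<^sub>R h \<in> ball x r" using n(3) by (simp add: dist_norm)
    from up[OF this] have 3: "F (x + t *\<^sub>R h) + G (x + t *\<^sub>R h)
        \<le> F x + G x + t * (\<xi> \<bullet> h) + t * (\<eta> \<bullet> h) + \<kappa> / 2 * (t\<^sup>2 * (norm h)\<^sup>2)"
      by (simp add: inner_add_left power_mult_distrib algebra_simps)
    have "t\<^sup>2 * (h \<bullet> S h + h \<bullet> T h - \<kappa> * (norm h)\<^sup>2) \<le> t\<^sup>2 * (e * (4 * (norm h)\<^sup>2))"
    proof -
      have "t\<^sup>2 * (h \<bullet> S h) / 2 + t\<^sup>2 * (h \<bullet> T h) / 2 \<le> \<kappa> / 2 * (t\<^sup>2 * (norm h)\<^sup>2) + 2 * (e * (t\<^sup>2 * (norm h)\<^sup>2))"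
        using 1 2 3 unfolding abs_le_iff by linarith
      then show ?thesis by (simp add: algebra_simps)
    qed
    then show ?thesis by (rule mult_left_le_imp_le) (use t in simp)
  qed
  then have "h \<bullet> S h + h \<bullet> T h - \<kappa> * (norm h)\<^sup>2 \<le> 0" by (rule le_zero_if_le_small_multiples)
  then show ?thesis by simp
qed

text \<open>The function \<open>q\<close> selects slopes of the semiconvex \<open>W\<close>. For
  each small \<open>p\<close>, maximize \<open>W\<close> minus the linear function of slope
  \<open>p\<close>: the maximizer is interior, is a contact point, and has \<open>q x = p\<close>
  because the upper and lower bounds meet there. So the image of the contact set contains a ball,
  while \<open>q\<close> is locally Lipschitz on it; a null set has no such image.\<close>

lemma not_negligible_contact_set:
  fixes W :: "'a::euclidean_space \<Rightarrow> real"
  assumes cont: "continuous_on (cball x0 r) W" and "r > 0" and "K \<ge> 0"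
    and low: "\<And>x y. W x + q x \<bullet> (y - x) - K * (norm (y - x))\<^sup>2 \<le> W y"
    and max: "\<And>x. x \<in> sphere x0 r \<Longrightarrow> W x < W x0"
  shows "\<not> negligible {x \<in> ball x0 r. \<forall>y\<in>cball x0 r. W y \<le> W x + q x \<bullet> (y - x)}" (is "\<not> negligible ?E")
proof
  assume neg: "negligible ?E"
  have "sphere x0 r \<noteq> {}" using \<open>r > 0\<close> by simp
  then obtain s where s: "s \<in> sphere x0 r" "\<And>x. x \<in> sphere x0 r \<Longrightarrow> W x \<le> W s"
    using continuous_attains_sup[OF compact_sphere, of x0 r W] continuous_on_subset[OF cont sphere_cball] by blast
  \<comment> \<open>The gap between centre and sphere, per unit of radius: a tilt of slope below
    \<rho> cannot move the maximum to the sphere.\<close>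
  define \<rho> where "\<rho> = (W x0 - W s) / r"
  have \<rho>: "\<rho> > 0" "\<rho> * r = W x0 - W s" using max[OF s(1)] \<open>r > 0\<close> by (simp_all add: \<rho>_def)
  have "ball 0 \<rho> \<subseteq> q ` ?E"
  proof
    fix p :: 'a assume p: "p \<in> ball 0 \<rho>"
    have "continuous_on (cball x0 r) (\<lambda>x. W x - p \<bullet> (x - x0))" by (intro continuous_intros cont)
    then obtain x where x: "x \<in> cball x0 r"
      "\<And>y. y \<in> cball x0 r \<Longrightarrow> W y - p \<bullet> (y - x0) \<le> W x - p \<bullet> (x - x0)"
      using continuous_attains_sup[OF compact_cball, of x0 r "\<lambda>x. W x - p \<bullet> (x - x0)"] \<open>r > 0\<close> by auto
    have "x \<notin> sphere x0 r"
    proof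
      assume xs: "x \<in> sphere x0 r"
      have "- (p \<bullet> (x - x0)) \<le> norm p * r"
        using Cauchy_Schwarz_ineq2[of p "x - x0"] xs by (simp add: dist_norm norm_minus_commute abs_le_iff)
      also have "\<dots> < \<rho> * r" using p \<open>r > 0\<close> by simp
      finally have "- (p \<bullet> (x - x0)) < W x0 - W s" using \<rho>(2) by simp
      then show False using s(2)[OF xs] x(2)[of x0] \<open>r > 0\<close> by simp
    qed
    then have xb: "x \<in> ball x0 r" using x(1) by auto
    have up: "W y \<le> W x + p \<bullet> (y - x)" if "y \<in> cball x0 r" for y
      using x(2)[OF that] by (simp add: inner_diff_right)
    obtain \<epsilon> where \<epsilon>: "\<epsilon> > 0" "ball x \<epsilon> \<subseteq> ball x0 r" using xb open_ball open_contains_ball by blast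
    have "(q x - p) \<bullet> (q x - p) \<le> 0"
    proof (rule le_zero_if_le_small_multiples)
      fix e :: real assume "e > 0"
      define d where "d = q x - p"
      define t where "t = min e (\<epsilon> / (2 * (norm d + 1)))"
      have nd: "norm d + 1 > 0" by (simp add: add_nonneg_pos)
      have t: "t > 0" "t \<le> e" using \<open>e > 0\<close> \<epsilon>(1) nd by (auto simp: t_def)
      have "norm (t *\<^sub>R d) \<le> t * (norm d + 1)" using t by simp
      also have "\<dots> \<le> \<epsilon> / (2 * (norm d + 1)) * (norm d + 1)" using nd by (intro mult_right_mono) (auto simp: t_def)
      also have "\<dots> < \<epsilon>" using nd \<epsilon>(1) by (simp add: divide_less_eq)
      finally have "x + t *\<^sub>R d \<in> ball x \<epsilon>" by (simp add: dist_norm)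
      then have "x + t *\<^sub>R d \<in> cball x0 r" using \<epsilon>(2) by auto
      from up[OF this] low[of x "x + t *\<^sub>R d"] 
      have "t * (d \<bullet> d) \<le> K * (norm (t *\<^sub>R d))\<^sup>2" by (simp add: d_def inner_diff_left algebra_simps)
      also have "\<dots> = t * (t * (K * (norm d)\<^sup>2))" by (simp add: power_mult_distrib power2_eq_square)
      finally have "d \<bullet> d \<le> t * (K * (norm d)\<^sup>2)" using t by simp
      also have "\<dots> \<le> e * (K * (norm d)\<^sup>2)" using t \<open>K \<ge> 0\<close> by (intro mult_right_mono) auto
      finally show "(q x - p) \<bullet> (q x - p) \<le> e * (K * (norm d)\<^sup>2)" by (simp add: d_def)
    qed
    then have "(q x - p) \<bullet> (q x - p) = 0" using inner_ge_zero[of "q x - p"] by linarith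
    then have "q x = p" by simp
    then show "p \<in> q ` ?E" using xb up by (auto intro!: image_eqI[of _ _ x])
  qed
  moreover have "negligible (q ` ?E)"
  proof (rule negligible_locally_Lipschitz_image[OF _ neg])
    fix x assume x: "x \<in> ?E"
    then obtain \<epsilon> where \<epsilon>: "\<epsilon> > 0" "ball x \<epsilon> \<subseteq> ball x0 r" using open_ball open_contains_ball by blast
    have "norm (q y - q x) \<le> (4 * K) * norm (y - x)" if y: "y \<in> ?E \<inter> ball x (\<epsilon> / 2)" for y
    proof (cases "q y = q x \<or> y = x")
      case False
      define t where "t = norm (y - x)"
      \<comment> \<open>The same test step as for calmness: length \<open>norm (y - x)\<close>,
        direction \<open>q y - q x\<close>.\<close>
      define v where "v = (t / norm (q y - q x)) *\<^sub>R (q y - q x)"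
      have t: "t > 0" using False by (simp add: t_def)
      have nv: "norm v = t" using False t by (simp add: v_def)
      have "t < \<epsilon>" using y \<epsilon>(1) by (simp add: t_def dist_norm norm_minus_commute)
      then have "x + v \<in> ball x \<epsilon>" using nv by (simp add: dist_norm)
      then have "x + v \<in> cball x0 r" using \<epsilon>(2) ball_subset_cball by blast
      then have "W (x + v) \<le> W x + q x \<bullet> v" using x by fastforce
      moreover have "W x \<le> W y + q y \<bullet> (x - y)" using x y by auto
      moreover have "W y + q y \<bullet> (x + v - y) - K * (norm (x + v - y))\<^sup>2 \<le> W (x + v)" by (rule low)
      moreover have "K * (norm (x + v - y))\<^sup>2 \<le> K * (2 * t)\<^sup>2"
      proof (intro mult_left_mono power_mono \<open>K \<ge> 0\<close>)
        have "norm (x + v - y) \<le> norm (x - y) + norm v" by (metis add_diff_eq add.commute norm_triangle_ineq)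
        then show "norm (x + v - y) \<le> 2 * t" using nv by (simp add: t_def norm_minus_commute)
      qed simp
      ultimately have "(q y - q x) \<bullet> v \<le> K * (2 * t)\<^sup>2"
        by (simp add: inner_diff_left inner_diff_right inner_add_right)
      moreover have "(q y - q x) \<bullet> v = norm (q y - q x) * t"
        using False by (simp add: v_def dot_square_norm power2_eq_square)
      ultimately have "norm (q y - q x) * t \<le> (4 * K * t) * t" by (simp add: power2_eq_square)
      then have "norm (q y - q x) \<le> 4 * K * t" using t by simp
      then show ?thesis by (simp add: t_def)
    qed (use \<open>K \<ge> 0\<close> in auto)
    then show "\<exists>T B. open T \<and> x \<in> T \<and> (\<forall>y\<in>?E \<inter> T. norm (q y - q x) \<le> B * norm (y - x))"
      using \<epsilon>(1) by (intro exI[of _ "ball x (\<epsilon> / 2)"] exI[of _ "4 * K"]) auto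
  qed simp
  ultimately have "negligible (ball (0::'a) \<rho>)" using negligible_subset by blast
  then show False using \<rho>(1) open_not_negligible[of "ball 0 \<rho> :: 'a set"] by simp
qed

text \<open>At a contact point of \<open>W\<close> the sum of \<open>F\<close> and \<open>G\<close>
  is bounded above by a quadratic. Subtracting the affine lower bound of one summand bounds the
  other, so Alexandrov's theorem applies to each, and the contact set, not being negligible, cannot
  lie in the two null sets of exceptions.\<close>

theorem jensen_second_order:
  fixes F G :: "'a::euclidean_space \<Rightarrow> real"
  assumes subF: "\<And>x. \<exists>\<xi>. subgradient F x \<xi> \<and> norm \<xi> \<le> L"
    and subG: "\<And>x. \<exists>\<xi>. subgradient G x \<xi> \<and> norm \<xi> \<le> L"
    and "\<kappa> \<ge> 0" and "r > 0"
    and max: "\<And>x. x \<in> sphere x0 r \<Longrightarrow> F x + G x - \<kappa> / 2 * (norm (x - x0))\<^sup>2 < F x0 + G x0"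
  obtains x \<xi> \<eta> S T where "x \<in> ball x0 r" "second_order_at F x \<xi> S" "second_order_at G x \<eta> T"
    "\<forall>h. h \<bullet> S h + h \<bullet> T h \<le> \<kappa> * (norm h)\<^sup>2"
proof -
  obtain f where f: "\<And>x. subgradient F x (f x)" using subF by metis
  obtain g where g: "\<And>x. subgradient G x (g x)" using subG by metis
  define W where "W x = F x + G x - \<kappa> / 2 * (norm (x - x0))\<^sup>2" for x
  define q where "q x = f x + g x - \<kappa> *\<^sub>R (x - x0)" for x
  have sq: "(norm (y - x0))\<^sup>2 = (norm (x - x0))\<^sup>2 + 2 * ((x - x0) \<bullet> (y - x)) + (norm (y - x))\<^sup>2" for x y
    unfolding power2_norm_eq_inner by (simp add: inner_diff_left inner_diff_right inner_commute)
  have low: "W x + q x \<bullet> (y - x) - \<kappa> / 2 * (norm (y - x))\<^sup>2 \<le> W y" for x y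
    using subgradientD[OF f, of x y] subgradientD[OF g, of x y] unfolding W_def q_def sq[of y x]
    by (simp add: inner_diff_left inner_add_left algebra_simps)
  have contW: "continuous_on (cball x0 r) W" unfolding W_def
    by (intro continuous_intros continuous_on_if_bounded_subgradients[OF subF] continuous_on_if_bounded_subgradients[OF subG])
  let ?E = "{x \<in> ball x0 r. \<forall>y\<in>cball x0 r. W y \<le> W x + q x \<bullet> (y - x)}"
  have nE: "\<not> negligible ?E"
    by (rule not_negligible_contact_set[OF contW \<open>r > 0\<close> _ low]) (use \<open>\<kappa> \<ge> 0\<close> max in \<open>auto simp: W_def\<close>)
  define N where "N F = {x. \<exists>\<xi> C r. subgradient F x \<xi> \<and> 0 \<le> C \<and> 0 < r \<and>
      (\<forall>y\<in>ball x r. F y \<le> F x + \<xi> \<bullet> (y - x) + C * (norm (y - x))\<^sup>2) \<and>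
      \<not> (\<exists>S. second_order_at F x \<xi> S)}" for F :: "'a \<Rightarrow> real"
  have "negligible (N F \<union> N G)" unfolding N_def
    by (intro negligible_Un alexandrov_at_contact_points[OF subF] alexandrov_at_contact_points[OF subG])
  then have "\<not> ?E \<subseteq> N F \<union> N G" using nE negligible_subset by blast
  then obtain x where x: "x \<in> ?E" "x \<notin> N F" "x \<notin> N G" by blast
  then obtain \<epsilon> where \<epsilon>: "\<epsilon> > 0" "ball x \<epsilon> \<subseteq> ball x0 r" using open_ball open_contains_ball by blast
  have up: "F y + G y \<le> F x + G x + (f x + g x) \<bullet> (y - x) + \<kappa> / 2 * (norm (y - x))\<^sup>2" if "y \<in> ball x \<epsilon>" for y
  proof -
    have "y \<in> cball x0 r" using that \<epsilon>(2) by auto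
    then have "W y \<le> W x + q x \<bullet> (y - x)" using x(1) by blast
    then show ?thesis unfolding W_def q_def sq[of y x]
      by (simp add: inner_diff_left inner_add_left algebra_simps)
  qed
  have upF: "F y \<le> F x + f x \<bullet> (y - x) + \<kappa> / 2 * (norm (y - x))\<^sup>2" if "y \<in> ball x \<epsilon>" for y
    using up[OF that] subgradientD[OF g, of x y] by (simp add: inner_add_left)
  obtain S where S: "second_order_at F x (f x) S"
  proof (rule ccontr)
    assume no: "\<not> thesis"
    have "x \<in> N F" unfolding N_def
    proof (rule CollectI, rule exI[of _ "f x"], rule exI[of _ "\<kappa> / 2"], rule exI[of _ \<epsilon>], intro conjI ballI)
      show "\<not> (\<exists>S. second_order_at F x (f x) S)" using no that by blast
    qed (use upF f \<epsilon>(1) \<open>\<kappa> \<ge> 0\<close> in auto)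
    then show False using x(2) by blast
  qed
  have upG: "G y \<le> G x + g x \<bullet> (y - x) + \<kappa> / 2 * (norm (y - x))\<^sup>2" if "y \<in> ball x \<epsilon>" for y
    using up[OF that] subgradientD[OF f, of x y] by (simp add: inner_add_left)
  obtain T where T: "second_order_at G x (g x) T"
  proof (rule ccontr)
    assume no: "\<not> thesis"
    have "x \<in> N G" unfolding N_def
    proof (rule CollectI, rule exI[of _ "g x"], rule exI[of _ "\<kappa> / 2"], rule exI[of _ \<epsilon>], intro conjI ballI)
      show "\<not> (\<exists>T. second_order_at G x (g x) T)" using no that by blast
    qed (use upG g \<epsilon>(1) \<open>\<kappa> \<ge> 0\<close> in auto)
    then show False using x(3) by blast
  qed
  show thesis
    by (rule that[OF _ S T]) (use x(1) second_order_sum_le[OF S T \<epsilon>(1) up] in auto)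
qed

text \<open>Adding \<open>c / 2 * (norm (x - x0))\<^sup>2\<close> cancels the square of
  \<open>x\<close> in the penalty and leaves, for each \<open>y\<close>, an affine function of
  \<open>x\<close> with slope \<open>c *\<^sub>R (y - x0)\<close>. The result is a supremum of such
  functions over \<open>y\<close> in the ball, hence the bound \<open>c * R\<close>.
  \<open>Y\<close> selects a maximizer.\<close>

lemma sup_convolution_exists:
  fixes u :: "'a::euclidean_space \<Rightarrow> real"
  assumes cont: "continuous_on (cball x0 R) u" and "R > 0" and "c > 0"
  shows "\<exists>f Y. (\<forall>x. Y x \<in> cball x0 R) \<and> (\<forall>x. f x = u (Y x) - c / 2 * (norm (x - Y x))\<^sup>2) \<and>
    (\<forall>x. \<forall>y\<in>cball x0 R. u y - c / 2 * (norm (x - y))\<^sup>2 \<le> f x) \<and>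
    (\<forall>x. \<exists>\<xi>. subgradient (\<lambda>x. f x + c / 2 * (norm (x - x0))\<^sup>2) x \<xi> \<and> norm \<xi> \<le> c * R)"
proof -
  have "\<exists>y\<in>cball x0 R. \<forall>y'\<in>cball x0 R. u y' - c / 2 * (norm (x - y'))\<^sup>2 \<le> u y - c / 2 * (norm (x - y))\<^sup>2" for x
    by (rule continuous_attains_sup) (use \<open>R > 0\<close> in \<open>auto intro!: continuous_intros cont\<close>)
  then obtain Y where Y: "\<And>x. Y x \<in> cball x0 R"
    "\<And>x y. y \<in> cball x0 R \<Longrightarrow> u y - c / 2 * (norm (x - y))\<^sup>2 \<le> u (Y x) - c / 2 * (norm (x - Y x))\<^sup>2"
    by metis
  define f where "f x = u (Y x) - c / 2 * (norm (x - Y x))\<^sup>2" for x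
  have "subgradient (\<lambda>x. f x + c / 2 * (norm (x - x0))\<^sup>2) x (c *\<^sub>R (Y x - x0))" for x
    unfolding subgradient_def
  proof
    fix z
    have sq: "(norm (a - x0))\<^sup>2 - (norm (a - Y x))\<^sup>2 = 2 * ((a - x0) \<bullet> (Y x - x0)) - (norm (Y x - x0))\<^sup>2" for a
      unfolding power2_norm_eq_inner by (simp add: inner_diff_left inner_diff_right inner_commute)
    have e: "c / 2 * (norm (a - x0))\<^sup>2 - c / 2 * (norm (a - Y x))\<^sup>2
        = c * ((a - x0) \<bullet> (Y x - x0)) - c / 2 * (norm (Y x - x0))\<^sup>2" for a
      unfolding right_diff_distrib[symmetric] sq by (simp add: right_diff_distrib)
    have "u (Y x) - c / 2 * (norm (z - Y x))\<^sup>2 \<le> f z" using Y unfolding f_def by blast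
    then show "f x + c / 2 * (norm (x - x0))\<^sup>2 + c *\<^sub>R (Y x - x0) \<bullet> (z - x) \<le> f z + c / 2 * (norm (z - x0))\<^sup>2"
      using e[of z] e[of x] by (simp add: f_def inner_diff_left inner_diff_right inner_commute algebra_simps)
  qed
  moreover have "norm (c *\<^sub>R (Y x - x0)) \<le> c * R" for x
    using Y(1)[of x] \<open>c > 0\<close> by (simp add: dist_norm norm_minus_commute)
  ultimately show ?thesis using Y f_def
    by (intro exI[of _ f] exI[of _ Y] conjI allI ballI) (metis, metis, metis, blast)
qed

definition quadratic_touches_above :: "('a::real_inner \<Rightarrow> real) \<Rightarrow> 'a \<Rightarrow> 'a \<Rightarrow> ('a \<Rightarrow> 'a) \<Rightarrow> bool" where
  "quadratic_touches_above u y \<xi> S \<longleftrightarrow>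
     (\<forall>\<^sub>F z in nhds y. u z \<le> u y + \<xi> \<bullet> (z - y) + ((z - y) \<bullet> S (z - y)) / 2)"

text \<open>Moving both arguments by a small \<open>h\<close> leaves the penalty unchanged, so
  \<open>u (y + h) - u y \<le> f (x + h) - f x\<close>: an upper expansion of \<open>f\<close> at
  \<open>x\<close> passes to \<open>u\<close> at the maximizer \<open>y\<close>. In the correction,
  \<open>c\<close> undoes the added square and \<open>e\<close> absorbs the error of the
  second-order expansion.\<close>

lemma sup_convolution_touching:
  fixes u :: "'a::euclidean_space \<Rightarrow> real"
  assumes fx: "f x = u y - c / 2 * (norm (x - y))\<^sup>2"
    and f: "\<And>z z'. z \<in> cball x0 R \<Longrightarrow> u z - c / 2 * (norm (z' - z))\<^sup>2 \<le> f z'"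
    and so: "second_order_at (\<lambda>x. f x + c / 2 * (norm (x - x0))\<^sup>2) x \<xi> S"
    and y: "y \<in> ball x0 R" and "e > 0"
  shows "\<exists>\<eta>. quadratic_touches_above u y \<eta> (\<lambda>h. S h - (c - e) *\<^sub>R h)"
proof -
  obtain d where d: "d > 0" "\<And>h. norm h < d \<Longrightarrow> \<bar>f (x + h) + c / 2 * (norm (x + h - x0))\<^sup>2
      - (f x + c / 2 * (norm (x - x0))\<^sup>2) - \<xi> \<bullet> h - (h \<bullet> S h) / 2\<bar> \<le> e / 2 * (norm h)\<^sup>2"
    using so \<open>e > 0\<close> unfolding second_order_at_def by (metis half_gt_zero)
  define \<eta> where "\<eta> = \<xi> - c *\<^sub>R (x - x0)"
  have "quadratic_touches_above u y \<eta> (\<lambda>h. S h - (c - e) *\<^sub>R h)"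
    unfolding quadratic_touches_above_def
  proof (rule eventually_nhds[THEN iffD2], intro exI conjI ballI)
    show "open (ball y d \<inter> ball x0 R)" by auto
    show "y \<in> ball y d \<inter> ball x0 R" using d(1) y by simp
    fix z assume z: "z \<in> ball y d \<inter> ball x0 R"
    define h where "h = z - y"
    have h: "norm h < d" using z by (simp add: h_def dist_norm norm_minus_commute)
    have "u z - c / 2 * (norm (x + h - z))\<^sup>2 \<le> f (x + h)" using f[of z "x + h"] z by simp
    moreover have "x + h - z = x - y" by (simp add: h_def)
    ultimately have uz: "u z - u y \<le> f (x + h) - f x" using fx by simp
    have up: "f (x + h) + c / 2 * (norm (x + h - x0))\<^sup>2
      - (f x + c / 2 * (norm (x - x0))\<^sup>2) - \<xi> \<bullet> h - (h \<bullet> S h) / 2 \<le> e / 2 * (norm h)\<^sup>2"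
      using d(2)[OF h] by linarith
    have sq: "(norm (x + h - x0))\<^sup>2 = (norm (x - x0))\<^sup>2 + 2 * ((x - x0) \<bullet> h) + (norm h)\<^sup>2"
      unfolding power2_norm_eq_inner by (simp add: inner_diff_left inner_diff_right inner_add_left inner_add_right inner_commute)
    have "c / 2 * (norm (x + h - x0))\<^sup>2 = c / 2 * (norm (x - x0))\<^sup>2 + c * ((x - x0) \<bullet> h) + c / 2 * (norm h)\<^sup>2"
      unfolding sq by (simp add: field_simps)
    then have "u z - u y \<le> \<xi> \<bullet> h + (h \<bullet> S h) / 2 + e / 2 * (norm h)\<^sup>2 - c * ((x - x0) \<bullet> h) - c / 2 * (norm h)\<^sup>2"
      using up uz by linarith
    also have "\<dots> = \<eta> \<bullet> h + (h \<bullet> (S h - (c - e) *\<^sub>R h)) / 2"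
      unfolding \<eta>_def inner_diff_left inner_diff_right inner_scaleR_left inner_scaleR_right dot_square_norm
      by (simp add: field_simps)
    finally show "u z \<le> u y + \<eta> \<bullet> (z - y) + ((z - y) \<bullet> (S (z - y) - (c - e) *\<^sub>R (z - y))) / 2"
      by (simp add: h_def)
  qed
  then show ?thesis by blast
qed

text \<open>The touching points are the maximizers of the two sup-convolutions at one common point,
  and are in general distinct. Of the concavity \<delta>, one half is spent on making the maximum
  strict and a quarter on the two expansion errors.\<close>

theorem doubling_touching_quadratics:
  fixes u v :: "'a::euclidean_space \<Rightarrow> real"
  assumes contu: "continuous_on (cball x0 R) u" and contv: "continuous_on (cball x0 R) v"
    and "R > 0" and "\<delta> > 0"
    and max: "\<And>x. x \<in> cball x0 R \<Longrightarrow> u x + v x + \<delta> / 2 * (norm (x - x0))\<^sup>2 \<le> u x0 + v x0"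
  obtains y y' \<xi> \<eta> S T where "y \<in> ball x0 R" "y' \<in> ball x0 R"
    "quadratic_touches_above u y \<xi> S" "quadratic_touches_above v y' \<eta> T" "linear S" "linear T"
    "\<forall>h. h \<bullet> S h + h \<bullet> T h \<le> - (\<delta> / 4) * (norm h)\<^sup>2"
proof -
  let ?B = "cball x0 R"
  \<comment> \<open>On the sphere of radius \<open>R / 2\<close> the hypothesis gives a gap of
    \<open>\<delta> * R\<^sup>2 / 8\<close>. The sup-convolutions cost at most
    \<open>2 * \<tau> = \<delta> * R\<^sup>2 / 32\<close>, less than the half of the gap that may be
    lost.\<close>
  define \<tau> where "\<tau> = \<delta> * R\<^sup>2 / 64"
  have \<tau>: "\<tau> > 0" using \<open>\<delta> > 0\<close> \<open>R > 0\<close> by (simp add: \<tau>_def)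
  obtain \<rho>1 where \<rho>1: "\<rho>1 > 0" "\<And>a b. a \<in> ?B \<Longrightarrow> b \<in> ?B \<Longrightarrow> dist b a < \<rho>1 \<Longrightarrow> dist (u b) (u a) < \<tau>"
    using compact_uniformly_continuous[OF contu compact_cball] \<tau> unfolding uniformly_continuous_on_def by metis
  obtain \<rho>2 where \<rho>2: "\<rho>2 > 0" "\<And>a b. a \<in> ?B \<Longrightarrow> b \<in> ?B \<Longrightarrow> dist b a < \<rho>2 \<Longrightarrow> dist (v b) (v a) < \<tau>"
    using compact_uniformly_continuous[OF contv compact_cball] \<tau> unfolding uniformly_continuous_on_def by metis
  obtain M1 where M1: "\<And>x. x \<in> ?B \<Longrightarrow> \<bar>u x\<bar> \<le> M1"
    using compact_imp_bounded[OF compact_continuous_image[OF contu compact_cball]] by (force simp: bounded_iff)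
  obtain M2 where M2: "\<And>x. x \<in> ?B \<Longrightarrow> \<bar>v x\<bar> \<le> M2"
    using compact_imp_bounded[OF compact_continuous_image[OF contv compact_cball]] by (force simp: bounded_iff)
  \<comment> \<open>\<open>R / 4\<close> keeps the maximizers of points within \<open>R / 2\<close>
    of \<open>x0\<close> inside the open ball of radius \<open>R\<close>.\<close>
  define \<rho> where "\<rho> = min (min \<rho>1 \<rho>2) (R / 4)"
  have \<rho>: "\<rho> > 0" "\<rho> \<le> \<rho>1" "\<rho> \<le> \<rho>2" "\<rho> \<le> R / 4" using \<rho>1(1) \<rho>2(1) \<open>R > 0\<close> by (auto simp: \<rho>_def)
  define M where "M = max M1 M2"
  have M0: "M \<ge> 0" using M1[of x0] \<open>R > 0\<close> by (auto simp: M_def)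
  \<comment> \<open>The second entry makes a displacement of at least \<rho> cost more than the
    oscillation \<open>2 * M\<close> of \<open>u\<close> or \<open>v\<close>; the first makes
    \<kappa> nonnegative below.\<close>
  define c where "c = max \<delta> (4 * M / \<rho>\<^sup>2 + 1)"
  have c: "c > 0" "c \<ge> \<delta>" using \<open>\<delta> > 0\<close> by (auto simp: c_def)
  have "4 * M < (4 * M / \<rho>\<^sup>2 + 1) * \<rho>\<^sup>2" using \<rho>(1) by (simp add: field_simps)
  also have "\<dots> \<le> c * \<rho>\<^sup>2" by (intro mult_right_mono) (auto simp: c_def)
  finally have cM: "4 * M < c * \<rho>\<^sup>2" .
  have near: "norm (x - y) < \<rho>"
    if "\<And>x. x \<in> ?B \<Longrightarrow> \<bar>w x\<bar> \<le> M" "x \<in> ?B" "y \<in> ?B" "w x \<le> w y - c / 2 * (norm (x - y))\<^sup>2" for x y and w :: "'a \<Rightarrow> real"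
  proof (rule ccontr)
    assume "\<not> norm (x - y) < \<rho>"
    then have "c * \<rho>\<^sup>2 \<le> c * (norm (x - y))\<^sup>2" using \<rho>(1) c(1) by (intro mult_left_mono power_mono) auto
    moreover have "c * (norm (x - y))\<^sup>2 \<le> 4 * M" using that(1)[OF that(2)] that(1)[OF that(3)] that(4) by linarith
    ultimately show False using cM by linarith
  qed
  obtain f Y where f': "\<forall>x. Y x \<in> ?B" "\<forall>x. f x = u (Y x) - c / 2 * (norm (x - Y x))\<^sup>2"
    "\<forall>x. \<forall>y\<in>?B. u y - c / 2 * (norm (x - y))\<^sup>2 \<le> f x"
    "\<forall>x. \<exists>\<xi>. subgradient (\<lambda>x. f x + c / 2 * (norm (x - x0))\<^sup>2) x \<xi> \<and> norm \<xi> \<le> c * R"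
    using sup_convolution_exists[OF contu \<open>R > 0\<close> c(1)] by blast
  note f = f'[rule_format]
  obtain g Z where g': "\<forall>x. Z x \<in> ?B" "\<forall>x. g x = v (Z x) - c / 2 * (norm (x - Z x))\<^sup>2"
    "\<forall>x. \<forall>y\<in>?B. v y - c / 2 * (norm (x - y))\<^sup>2 \<le> g x"
    "\<forall>x. \<exists>\<xi>. subgradient (\<lambda>x. g x + c / 2 * (norm (x - x0))\<^sup>2) x \<xi> \<and> norm \<xi> \<le> c * R"
    using sup_convolution_exists[OF contv \<open>R > 0\<close> c(1)] by blast
  note g = g'[rule_format]
  have Yn: "norm (x - Y x) < \<rho>" if "x \<in> ?B" for x
    by (rule near[of u]) (use M1 f(1) f(2)[of x] f(3)[of x x] that in \<open>force simp: M_def\<close>)+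
  have Zn: "norm (x - Z x) < \<rho>" if "x \<in> ?B" for x
    by (rule near[of v]) (use M2 g(1) g(2)[of x] g(3)[of x x] that in \<open>force simp: M_def\<close>)+
  have fu: "f x \<le> u x + \<tau>" if "x \<in> ?B" for x
  proof -
    have "dist (u (Y x)) (u x) < \<tau>" using \<rho>1(2)[OF that f(1)[of x]] Yn[OF that] \<rho>(2) by (simp add: dist_norm norm_minus_commute)
    moreover have "f x \<le> u (Y x)" using f(2)[of x] c(1) by simp
    ultimately show ?thesis by (simp add: dist_real_def)
  qed
  have gv: "g x \<le> v x + \<tau>" if "x \<in> ?B" for x
  proof -
    have "dist (v (Z x)) (v x) < \<tau>" using \<rho>2(2)[OF that g(1)[of x]] Zn[OF that] \<rho>(3) by (simp add: dist_norm norm_minus_commute)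
    moreover have "g x \<le> v (Z x)" using g(2)[of x] c(1) by simp
    ultimately show ?thesis by (simp add: dist_real_def)
  qed
  \<comment> \<open>\<open>2 * c\<close> accounts for the two added squares;
    \<open>\<delta> / 2\<close> is the part of the concavity that is kept.\<close>
  define \<kappa> where "\<kappa> = 2 * c - \<delta> / 2"
  have \<kappa>: "\<kappa> \<ge> 0" using c \<open>\<delta> > 0\<close> by (simp add: \<kappa>_def)
  have strict: "f x + c / 2 * (norm (x - x0))\<^sup>2 + (g x + c / 2 * (norm (x - x0))\<^sup>2) - \<kappa> / 2 * (norm (x - x0))\<^sup>2
      < f x0 + c / 2 * (norm (x0 - x0))\<^sup>2 + (g x0 + c / 2 * (norm (x0 - x0))\<^sup>2)"
    if x: "x \<in> sphere x0 (R / 2)" for x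
  proof -
    have xB: "x \<in> ?B" using x \<open>R > 0\<close> by simp
    have nR: "norm (x - x0) = R / 2" using x by (simp add: dist_norm norm_minus_commute)
    have n: "(norm (x - x0))\<^sup>2 = R\<^sup>2 / 4" by (subst nR) (simp add: power_divide)
    have "f x + g x \<le> u x + v x + 2 * \<tau>" using fu[OF xB] gv[OF xB] by simp
    also have "\<dots> \<le> u x0 + v x0 - \<delta> / 2 * (R\<^sup>2 / 4) + 2 * \<tau>" using max[OF xB] n by simp
    also have "\<dots> < u x0 + v x0 - \<delta> / 4 * (R\<^sup>2 / 4)" using \<tau> by (simp add: \<tau>_def)
    also have "u x0 + v x0 \<le> f x0 + g x0" using f(3)[of x0 x0] g(3)[of x0 x0] \<open>R > 0\<close> by simp
    finally have "f x + g x + \<delta> / 4 * (R\<^sup>2 / 4) < f x0 + g x0" by simp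
    then show ?thesis unfolding n by (simp add: \<kappa>_def field_simps)
  qed
  have R2: "R / 2 > 0" using \<open>R > 0\<close> by simp
  obtain x \<xi> \<eta> S T where x: "x \<in> ball x0 (R / 2)"
    and S: "second_order_at (\<lambda>x. f x + c / 2 * (norm (x - x0))\<^sup>2) x \<xi> S"
    and T: "second_order_at (\<lambda>x. g x + c / 2 * (norm (x - x0))\<^sup>2) x \<eta> T"
    and ST: "\<forall>h. h \<bullet> S h + h \<bullet> T h \<le> \<kappa> * (norm h)\<^sup>2"
    by (rule jensen_second_order[OF f(4) g(4) \<kappa> R2 strict])
  have xB: "x \<in> ?B" using x \<open>R > 0\<close> by simp
  have "dist x0 (Y x) \<le> dist x0 x + dist x (Y x)" "dist x0 (Z x) \<le> dist x0 x + dist x (Z x)"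
    by (rule dist_triangle)+
  then have YZ: "Y x \<in> ball x0 R" "Z x \<in> ball x0 R"
    using x Yn[OF xB] Zn[OF xB] \<rho>(4) \<open>R > 0\<close> by (simp_all add: dist_norm)
  let ?S = "\<lambda>h. S h - (c - \<delta> / 8) *\<^sub>R h" and ?T = "\<lambda>h. T h - (c - \<delta> / 8) *\<^sub>R h"
  obtain \<xi>' where \<xi>': "quadratic_touches_above u (Y x) \<xi>' ?S"
    using sup_convolution_touching[OF f(2) f(3) S YZ(1), of "\<delta> / 8"] \<open>\<delta> > 0\<close> by auto
  obtain \<eta>' where \<eta>': "quadratic_touches_above v (Z x) \<eta>' ?T"
    using sup_convolution_touching[OF g(2) g(3) T YZ(2), of "\<delta> / 8"] \<open>\<delta> > 0\<close> by auto
  have "linear ?S" "linear ?T"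
    using S T by (auto simp: second_order_at_def intro!: linear_compose_sub linear_scale_self)
  moreover have "h \<bullet> ?S h + h \<bullet> ?T h \<le> - (\<delta> / 4) * (norm h)\<^sup>2" for h
    using ST[rule_format, of h] by (simp add: \<kappa>_def inner_diff_right dot_square_norm algebra_simps)
  ultimately show thesis using that[OF YZ \<xi>' \<eta>'] by blast
qed

subsection \<open>The maximum principle\<close>

text \<open>\<open>F\<close> consists of symmetric matrices, while the derivative found for a
  subdifferential is only known to be linear; its symmetric part has the same quadratic
  form.\<close>

definition sym_matrix :: "(real^'n \<Rightarrow> real^'n) \<Rightarrow> real^'n^'n" where
  "sym_matrix S = (1 / 2) *\<^sub>R (matrix S + transpose (matrix S))"

lemma transpose_add: "transpose (A + B) = transpose A + transpose (B :: real^'n^'m)"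
  by (simp add: transpose_def vec_eq_iff)

lemma sym_matrix_in_Sym2: "sym_matrix S \<in> Sym2"
  by (simp add: sym_matrix_def Sym2_def transpose_scalar transpose_add add.commute)

lemma dot_transpose: "x \<bullet> (transpose A *v y) = (A *v x) \<bullet> (y :: real^'n)"
  by (metis dot_lmul_matrix inner_commute transpose_matrix_vector)

lemma inner_sym_matrix:
  assumes "linear S"
  shows "h \<bullet> (sym_matrix S *v h) = h \<bullet> S h"
proof -
  have "h \<bullet> (sym_matrix S *v h) = (h \<bullet> (matrix S *v h) + h \<bullet> (transpose (matrix S) *v h)) / 2"
    by (simp add: sym_matrix_def scaleR_matrix_vector_assoc[symmetric] matrix_vector_mult_add_rdistrib inner_add_right)
  also have "h \<bullet> (transpose (matrix S) *v h) = (matrix S *v h) \<bullet> h" by (rule dot_transpose)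
  also have "matrix S *v h = S h" using assms by (simp add: matrix_works)
  finally show ?thesis by (simp add: inner_commute)
qed

lemma norm_matrix_vector_mult_le:
  fixes M :: "real^'n^'m"
  shows "norm (M *v h) \<le> norm M * norm h"
proof -
  have "norm (M *v h) = L2_set (\<lambda>i. \<bar>M $ i \<bullet> h\<bar>) UNIV"
    by (simp add: norm_vec_def matrix_vector_mul_component)
  also have "\<dots> \<le> L2_set (\<lambda>i. norm (M $ i) * norm h) UNIV"
    by (intro L2_set_mono) (auto simp: Cauchy_Schwarz_ineq2)
  also have "\<dots> = norm M * norm h"
    by (simp add: norm_vec_def L2_set_left_distrib)
  finally show ?thesis .
qed

lemma C2_hessian_quadratic:
  assumes "A \<in> Sym2"
  shows "C2_hessian (\<lambda>z. c + \<xi> \<bullet> (z - y) + ((z - y) \<bullet> (A *v (z - y))) / 2) y A"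
  unfolding C2_hessian_def
proof (intro exI conjI ballI)
  have sym: "x \<bullet> (A *v z) = (A *v x) \<bullet> z" for x z
    using assms dot_transpose[of x A z] by (simp add: Sym2_def)
  have bl: "bounded_linear ((*v) A)" by (rule matrix_vector_mul_bounded_linear)
  show "(0::real) < 1" by simp
  fix x assume "x \<in> ball y 1"
  have "((\<lambda>z. A *v (z - y)) has_derivative (\<lambda>h. A *v h)) (at x)"
    by (rule bounded_linear.has_derivative[OF bl]) (auto intro!: derivative_eq_intros)
  then have q: "((\<lambda>z. (z - y) \<bullet> (A *v (z - y))) has_derivative (\<lambda>h. (x - y) \<bullet> (A *v h) + h \<bullet> (A *v (x - y)))) (at x)"
    by (intro has_derivative_inner) (auto intro!: derivative_eq_intros)
  have "((\<lambda>z. \<xi> \<bullet> (z - y)) has_derivative (\<lambda>h. \<xi> \<bullet> h)) (at x)"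
    by (auto intro!: derivative_eq_intros)
  from has_derivative_add[OF has_derivative_add[OF has_derivative_const this] has_derivative_mult_left[OF q]]
  have "((\<lambda>z. c + \<xi> \<bullet> (z - y) + (z - y) \<bullet> (A *v (z - y)) * (1 / 2)) has_derivative
      (\<lambda>h. 0 + \<xi> \<bullet> h + ((x - y) \<bullet> (A *v h) + h \<bullet> (A *v (x - y))) * (1 / 2))) (at x)" .
  moreover have "0 + \<xi> \<bullet> h + ((x - y) \<bullet> (A *v h) + h \<bullet> (A *v (x - y))) * (1 / 2) = (\<xi> + A *v (x - y)) \<bullet> h" for h
    unfolding sym[of "x - y" h] inner_commute[of h "A *v (x - y)"] by (simp add: inner_add_left)
  ultimately show "((\<lambda>z. c + \<xi> \<bullet> (z - y) + ((z - y) \<bullet> (A *v (z - y))) / 2) has_derivative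
      (\<lambda>h. (\<xi> + A *v (x - y)) \<bullet> h)) (at x)"
    by simp
  show "((\<lambda>x. \<xi> + A *v (x - y)) has_derivative (\<lambda>h. A *v h)) (at x)"
    by (rule derivative_eq_intros bounded_linear.has_derivative[OF bl] refl)+ simp
qed auto

text \<open>The viscosity condition for quadratic test functions and real-valued \<open>u\<close>.
  Semicontinuity is left out, since continuity is assumed separately where it matters.\<close>

definition quad_subharmonic :: "(real^'n^'n) set \<Rightarrow> (real^'n) set \<Rightarrow> (real^'n \<Rightarrow> real) \<Rightarrow> bool" where
  "quad_subharmonic F X u \<longleftrightarrow>
     (\<forall>y\<in>X. \<forall>\<xi> S. linear S \<longrightarrow> quadratic_touches_above u y \<xi> S \<longrightarrow> sym_matrix S \<in> F)"

lemma quad_subharmonic_if_F_subharmonic: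
  assumes "F_subharmonic F X (\<lambda>x. ereal (u x))"
  shows "quad_subharmonic F X u"
  unfolding quad_subharmonic_def
proof (intro ballI allI impI)
  fix y \<xi> S assume y: "y \<in> X" and S: "linear S" and touch: "quadratic_touches_above u y \<xi> S"
  let ?\<phi> = "\<lambda>z. u y + \<xi> \<bullet> (z - y) + ((z - y) \<bullet> (sym_matrix S *v (z - y))) / 2"
  have "touches_above (\<lambda>x. ereal (u x)) y ?\<phi>"
    using touch by (simp add: touches_above_def quadratic_touches_above_def inner_sym_matrix[OF S])
  then have "test_fn (\<lambda>x. ereal (u x)) y ?\<phi> (sym_matrix S)"
    using C2_hessian_quadratic[OF sym_matrix_in_Sym2] by (simp add: test_fn_def)
  then show "sym_matrix S \<in> F" using assms y unfolding F_subharmonic_def by blast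
qed

text \<open>\<open>F\<close> restricts Hessians only, so affine terms are free. They serve to
  re-centre a quadratic perturbation at its maximum point.\<close>

lemma quad_subharmonic_add_affine:
  assumes "quad_subharmonic F X u"
  shows "quad_subharmonic F X (\<lambda>x. u x + p \<bullet> (x - a))"
  unfolding quad_subharmonic_def
proof (intro ballI allI impI)
  fix y \<xi> S assume y: "y \<in> X" and S: "linear S"
    and touch: "quadratic_touches_above (\<lambda>x. u x + p \<bullet> (x - a)) y \<xi> S"
  have "quadratic_touches_above u y (\<xi> - p) S"
    using touch unfolding quadratic_touches_above_def
    by eventually_elim (simp add: inner_diff_left inner_diff_right)
  then show "sym_matrix S \<in> F" using assms y S unfolding quad_subharmonic_def by blast
qed

text \<open>This is where the cone property enters: it makes the factor
  \<open>1 + \<epsilon>\<close> admissible.\<close>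

lemma quad_subharmonic_scale:
  assumes F: "cone_subequation F" and u: "quad_subharmonic F X u" and "t > 0"
  shows "quad_subharmonic F X (\<lambda>x. t * u x)"
  unfolding quad_subharmonic_def
proof (intro ballI allI impI)
  fix y \<xi> S assume y: "y \<in> X" and S: "linear S"
    and touch: "quadratic_touches_above (\<lambda>x. t * u x) y \<xi> S"
  let ?S = "\<lambda>h. (1 / t) *\<^sub>R S h"
  have "quadratic_touches_above u y ((1 / t) *\<^sub>R \<xi>) ?S"
    using touch unfolding quadratic_touches_above_def
  proof eventually_elim
    case (elim z)
    then show ?case
      using mult_left_mono[OF elim, of "1 / t"] \<open>t > 0\<close> by (simp add: distrib_left)
  qed
  moreover have "linear ?S" using S by (rule linear_compose_scale_right)
  ultimately have "sym_matrix ?S \<in> F" using u y unfolding quad_subharmonic_def by blast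
  moreover have "sym_matrix S = t *\<^sub>R sym_matrix ?S"
    using \<open>t > 0\<close> by (simp add: sym_matrix_def matrix_def transpose_def vec_eq_iff field_simps)
  ultimately show "sym_matrix S \<in> F"
    using F \<open>t > 0\<close> unfolding cone_subequation_def by (metis imageI)
qed

text \<open>Every symmetric \<open>C\<close> within \<open>e\<close> of \<open>- B\<close> dominates
  \<open>A\<close> and so lies in \<open>F\<close> by positivity. Then \<open>- B\<close> is
  interior to \<open>F\<close>, against the definition of the dual.\<close>

lemma dual_subeq_not_opposite:
  assumes F: "cone_subequation F" and A: "A \<in> F" and B: "B \<in> dual_subeq F" and "e > 0"
    and neg: "\<And>h. h \<bullet> (A *v h) + h \<bullet> (B *v h) \<le> - e * (norm h)\<^sup>2"
  shows False
proof -
  have AS: "A \<in> Sym2" and BS: "B \<in> Sym2"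
    using F A B by (auto simp: cone_subequation_def dual_subeq_def)
  have near: "C \<in> F" if C: "C \<in> Sym2" and d: "dist C (- B) < e" for C
  proof -
    have "psd (C - A)" unfolding psd_def
    proof (intro conjI allI)
      show "C - A \<in> Sym2" using C AS by (simp add: Sym2_def transpose_def vec_eq_iff)
      fix h
      have "\<bar>h \<bullet> ((C + B) *v h)\<bar> \<le> norm h * norm ((C + B) *v h)" by (rule Cauchy_Schwarz_ineq2)
      also have "\<dots> \<le> norm h * (norm (C + B) * norm h)"
        by (intro mult_left_mono norm_matrix_vector_mult_le) simp
      also have "\<dots> = norm (C + B) * (norm h)\<^sup>2" by (simp add: power2_eq_square)
      also have "\<dots> \<le> e * (norm h)\<^sup>2" using d by (intro mult_right_mono) (auto simp: dist_norm)
      finally have "- (h \<bullet> ((C + B) *v h)) \<le> e * (norm h)\<^sup>2" by simp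
      then show "0 \<le> h \<bullet> ((C - A) *v h)"
        using neg[of h] by (simp add: matrix_vector_mult_diff_rdistrib matrix_vector_mult_add_rdistrib inner_diff_right inner_add_right)
    qed
    then have "A + (C - A) \<in> F" using F A unfolding cone_subequation_def by blast
    then show ?thesis by simp
  qed
  have "- B \<in> Sym2" using BS by (simp add: Sym2_def transpose_def vec_eq_iff)
  then have "- B \<in> sym_interior F" using near \<open>e > 0\<close> by (auto simp: sym_interior_def)
  then show False using B by (simp add: dual_subeq_def)
qed

theorem maximum_principle_compact:
  fixes u v :: "real^'n \<Rightarrow> real"
  assumes F: "cone_subequation F" and u: "quad_subharmonic F X u" and v: "quad_subharmonic (dual_subeq F) X v"
    and K: "compact K" "K \<subseteq> X" and contu: "continuous_on K u" and contv: "continuous_on K v" and a: "a \<in> K"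
  shows "\<exists>x\<in>frontier K. u a + v a \<le> u x + v x"
proof (rule ccontr)
  assume "\<not> ?thesis"
  then have less: "\<And>x. x \<in> frontier K \<Longrightarrow> u x + v x < u a + v a" by force
  let ?w = "\<lambda>x. u x + v x"
  have fK: "frontier K \<subseteq> K" using K(1) by (simp add: compact_imp_closed frontier_subset_eq)
  have contw: "continuous_on K ?w" by (intro continuous_intros contu contv)
  obtain m where m: "m < ?w a" "\<And>x. x \<in> frontier K \<Longrightarrow> ?w x \<le> m"
  proof (cases "frontier K = {}")
    case True
    then show thesis using that[of "?w a - 1"] by simp
  next
    case False
    then obtain s where "s \<in> frontier K" "\<And>x. x \<in> frontier K \<Longrightarrow> ?w x \<le> ?w s"
      using continuous_attains_sup[OF compact_frontier[OF K(1)], of ?w] continuous_on_subset[OF contw fK] by blast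
    then show thesis using that[of "?w s"] less by blast
  qed
  obtain D where D: "D > 0" "\<And>x. x \<in> K \<Longrightarrow> norm (x - a) \<le> D"
  proof -
    have "bounded ((\<lambda>x. x - a) ` K)"
      using K(1) by (simp add: bounded_translation_minus compact_imp_bounded)
    then show thesis using that unfolding bounded_pos by blast
  qed
  \<comment> \<open>The perturbation vanishes at \<open>a\<close> and is at most half the gap
    \<open>?w a - m\<close> on \<open>K\<close>, so the perturbed maximum is still off the
    frontier.\<close>
  define \<delta> where "\<delta> = (?w a - m) / D\<^sup>2"
  have \<delta>: "\<delta> > 0" "\<delta> * D\<^sup>2 = ?w a - m" using m(1) D(1) by (simp_all add: \<delta>_def)
  have "continuous_on K (\<lambda>x. ?w x + \<delta> / 2 * (norm (x - a))\<^sup>2)" by (intro continuous_intros contw)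
  then obtain p where p: "p \<in> K" "\<And>x. x \<in> K \<Longrightarrow> ?w x + \<delta> / 2 * (norm (x - a))\<^sup>2 \<le> ?w p + \<delta> / 2 * (norm (p - a))\<^sup>2"
    using continuous_attains_sup[OF K(1), of "\<lambda>x. ?w x + \<delta> / 2 * (norm (x - a))\<^sup>2"] a by blast
  have "p \<notin> frontier K"
  proof
    assume "p \<in> frontier K"
    then have "?w p \<le> m" by (rule m(2))
    moreover have "\<delta> * (norm (p - a))\<^sup>2 \<le> \<delta> * D\<^sup>2"
      using \<delta>(1) D(2)[OF p(1)] by (intro mult_left_mono power_mono) auto
    ultimately show False using p(2)[OF a] \<delta>(2) m(1) by simp
  qed
  then have "p \<in> interior K" using p(1) closure_subset[of K] by (auto simp: frontier_def)
  then obtain R where R: "R > 0" "cball p R \<subseteq> K" by (auto simp: mem_interior_cball)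
  \<comment> \<open>Expand the square about \<open>p\<close>: the linear term is given to
    \<open>u\<close>, and the pure square remains as strict concavity about
    \<open>p\<close>.\<close>
  define u' where "u' x = u x + (\<delta> *\<^sub>R (p - a)) \<bullet> (x - p)" for x
  have u': "quad_subharmonic F X u'" unfolding u'_def using u by (rule quad_subharmonic_add_affine)
  have contu': "continuous_on (cball p R) u'" unfolding u'_def
    by (intro continuous_intros continuous_on_subset[OF contu R(2)])
  have max: "u' x + v x + \<delta> / 2 * (norm (x - p))\<^sup>2 \<le> u' p + v p" if "x \<in> cball p R" for x
  proof -
    have sq: "(norm (x - a))\<^sup>2 = (norm (p - a))\<^sup>2 + 2 * ((p - a) \<bullet> (x - p)) + (norm (x - p))\<^sup>2"
      unfolding power2_norm_eq_inner by (simp add: inner_diff_left inner_diff_right inner_commute)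
    have "?w x + \<delta> / 2 * (norm (x - a))\<^sup>2 \<le> ?w p + \<delta> / 2 * (norm (p - a))\<^sup>2" using p(2) R(2) that by blast
    then show ?thesis unfolding sq u'_def inner_scaleR_left by (simp add: field_simps)
  qed
  obtain y y' \<xi> \<eta> S T where yy: "y \<in> ball p R" "y' \<in> ball p R"
    "quadratic_touches_above u' y \<xi> S" "quadratic_touches_above v y' \<eta> T" "linear S" "linear T"
    "\<forall>h. h \<bullet> S h + h \<bullet> T h \<le> - (\<delta> / 4) * (norm h)\<^sup>2"
    by (rule doubling_touching_quadratics[OF contu' continuous_on_subset[OF contv R(2)] R(1) \<delta>(1) max])
  have yX: "y \<in> X" "y' \<in> X" using yy(1,2) R(2) K(2) by (auto simp: subset_eq)
  have "sym_matrix S \<in> F" using u' yX(1) yy(3,5) unfolding quad_subharmonic_def by blast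
  moreover have "sym_matrix T \<in> dual_subeq F" using v yX(2) yy(4,6) unfolding quad_subharmonic_def by blast
  ultimately show False
    using dual_subeq_not_opposite[OF F, of "sym_matrix S" "sym_matrix T" "\<delta> / 4"] yy(5-7) \<delta>(1)
    by (simp add: inner_sym_matrix)
qed

text \<open>Near \<open>Q\<close> the values are below \<open>w z\<close>, so the maximum over the
  rest is attained. The set of all maximum points is compact and avoids both \<open>P\<close> and
  the frontier; on a compact neighbourhood of it the comparison principle finds a maximum point on
  the boundary, where none is left. Taking the whole set matters: around a single maximum point the
  boundary could contain others.\<close>

theorem maximum_principle_punctured:
  fixes u v :: "real^'n \<Rightarrow> real"
  defines "w \<equiv> \<lambda>x. u x + v x"
  assumes F: "cone_subequation F" and "open \<Omega>" and "bounded \<Omega>"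
    and P: "finite P" "P \<subseteq> \<Omega>" and Q: "Q \<subseteq> P"
    and u: "quad_subharmonic F (\<Omega> - P) u" and v: "quad_subharmonic (dual_subeq F) (\<Omega> - P) v"
    and contu: "continuous_on (closure \<Omega> - P) u" and contv: "continuous_on (closure \<Omega> - P) v"
    and polar: "\<And>q c. q \<in> Q \<Longrightarrow> \<forall>\<^sub>F x in at q. w x < c"
    and fin_cont: "\<And>p. p \<in> P - Q \<Longrightarrow> (w \<longlongrightarrow> w p) (at p)"
    and fin_min: "\<And>p. p \<in> P - Q \<Longrightarrow> \<forall>\<^sub>F x in at p. w p < w x"
    and z: "z \<in> closure \<Omega> - Q"
  shows "\<exists>x\<in>frontier \<Omega>. w z \<le> w x"
proof (rule ccontr)
  assume "\<not> ?thesis"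
  then have less: "\<And>x. x \<in> frontier \<Omega> \<Longrightarrow> w x < w z" by force
  have contw0: "continuous_on (closure \<Omega> - P) w" unfolding w_def by (intro continuous_intros contu contv)
  have openX: "open (\<Omega> - P)" using \<open>open \<Omega>\<close> P(1) by (simp add: open_Diff finite_imp_closed)
  have contw: "continuous_on (closure \<Omega> - Q) w"
    unfolding continuous_on_def
  proof
    fix x assume x: "x \<in> closure \<Omega> - Q"
    show "(w \<longlongrightarrow> w x) (at x within closure \<Omega> - Q)"
    proof (cases "x \<in> P")
      case True
      then show ?thesis using fin_cont[of x] x by (auto intro: tendsto_within_subset)
    next
      case False
      have "(w \<longlongrightarrow> w x) (at x within closure \<Omega> - P)"
        using contw0 x False unfolding continuous_on_def by blast
      moreover have "at x within closure \<Omega> - P = at x within closure \<Omega> - Q"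
        by (rule at_within_nhd[of _ "- P"]) (use False P(1) Q in \<open>auto simp: finite_imp_closed open_Compl\<close>)
      ultimately show ?thesis by simp
    qed
  qed
  have "\<exists>r>0. \<forall>x. x \<noteq> q \<and> dist x q < r \<longrightarrow> w x < w z" if "q \<in> Q" for q
    using polar[OF that, of "w z"] by (auto simp: eventually_at)
  then obtain r where r: "\<And>q. q \<in> Q \<Longrightarrow> r q > 0"
    "\<And>q x. q \<in> Q \<Longrightarrow> x \<noteq> q \<Longrightarrow> dist x q < r q \<Longrightarrow> w x < w z" by metis
  \<comment> \<open>\<open>z\<close> stays in \<open>K\<close>, because the removed balls contain,
    besides their centres, only points with smaller values.\<close>
  define K where "K = closure \<Omega> - (\<Union>q\<in>Q. ball q (r q))"
  have KQ: "K \<subseteq> closure \<Omega> - Q" using r(1) by (auto simp: K_def)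
  have Kc: "compact K" unfolding K_def
    using \<open>bounded \<Omega>\<close> by (intro compact_diff) (auto simp: compact_closure)
  have zK: "z \<in> K" using z r(2)[of _ z] by (force simp: K_def dist_commute)
  obtain p where p: "p \<in> K" "\<And>x. x \<in> K \<Longrightarrow> w x \<le> w p"
    using continuous_attains_sup[OF Kc _ continuous_on_subset[OF contw KQ]] zK by blast
  have pmax: "w x \<le> w p" if xcl: "x \<in> closure \<Omega> - Q" for x
  proof (cases "x \<in> K")
    case False
    then obtain q where q: "q \<in> Q" "x \<in> ball q (r q)" using xcl unfolding K_def by blast
    moreover have "x \<noteq> q" using q(1) xcl by blast
    ultimately show ?thesis using r(2)[of q x] p(2)[OF zK] by (simp add: dist_commute)
  qed (rule p(2))
  define A where "A = {x \<in> K. w x = w p}"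
  have Ac: "compact A"
  proof -
    have "closed A" unfolding A_def
      using continuous_closed_preimage_constant[OF continuous_on_subset[OF contw KQ] compact_imp_closed[OF Kc]] .
    moreover have "A = K \<inter> A" by (auto simp: A_def)
    ultimately show ?thesis using compact_Int_closed[OF Kc] by metis
  qed
  have AX: "A \<subseteq> \<Omega> - P"
  proof
    fix x assume x: "x \<in> A"
    then have xK: "x \<in> closure \<Omega> - Q" and wx: "w x = w p" using KQ by (auto simp: A_def)
    have "x \<notin> frontier \<Omega>" using less[of x] p(2)[OF zK] wx by auto
    then have x\<Omega>: "x \<in> \<Omega>" using xK \<open>open \<Omega>\<close> by (auto simp: frontier_def interior_open)
    have "x \<notin> P"
    proof
      assume "x \<in> P"
      \<comment> \<open>Not being in \<open>Q\<close>, such an \<open>x\<close> is of finite type,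
        and the strict minimum there would give larger values nearby.\<close>
      then have "\<forall>\<^sub>F y in at x. w x < w y" using fin_min xK by blast
      moreover have "\<forall>\<^sub>F y in at x. y \<in> \<Omega>" using x\<Omega> \<open>open \<Omega>\<close> by (simp add: eventually_at_in_open')
      moreover have "\<forall>\<^sub>F y in at x. y \<notin> Q"
        using eventually_at_in_open'[of "- Q" x] xK finite_subset[OF Q P(1)]
        by (simp add: finite_imp_closed open_Compl)
      ultimately have "\<forall>\<^sub>F y in at x. False"
      proof eventually_elim
        case (elim y)
        then show ?case using pmax[of y] wx closure_subset by force
      qed
      then show False by simp
    qed
    then show "x \<in> \<Omega> - P" using x\<Omega> by simp
  qed
  obtain e where e: "e > 0" "(\<Union>x\<in>A. cball x e) \<subseteq> \<Omega> - P"
    using compact_subset_open_imp_cball_epsilon_subset[OF Ac openX AX] by blast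
  define N where "N = {x + y | x y. x \<in> A \<and> y \<in> cball 0 e}"
  have Nc: "compact N" unfolding N_def using Ac by (intro compact_sums) auto
  have NX: "N \<subseteq> \<Omega> - P"
  proof
    fix n assume "n \<in> N"
    then obtain x y where "n = x + y" "x \<in> A" "y \<in> cball 0 e" by (auto simp: N_def)
    then have "n \<in> cball x e" by (simp add: dist_norm)
    then show "n \<in> \<Omega> - P" using e(2) \<open>x \<in> A\<close> by blast
  qed
  have AN: "A \<subseteq> interior N"
  proof
    fix x assume x: "x \<in> A"
    have "ball x e \<subseteq> N"
    proof
      fix y assume "y \<in> ball x e"
      then have "y - x \<in> cball 0 e" by (simp add: dist_norm norm_minus_commute)
      then show "y \<in> N" unfolding N_def using x by (intro CollectI exI[of _ x] exI[of _ "y - x"]) simp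
    qed
    then show "x \<in> interior N" using e(1) by (auto simp: mem_interior)
  qed
  have Ncl: "N \<subseteq> closure \<Omega> - P" using NX closure_subset by blast
  have "p \<in> A" using p(1) by (simp add: A_def)
  then have "p \<in> N" using AN interior_subset by blast
  then obtain x where x: "x \<in> frontier N" "w p \<le> w x"
    using maximum_principle_compact[OF F u v Nc NX continuous_on_subset[OF contu Ncl] continuous_on_subset[OF contv Ncl]]
    unfolding w_def by blast
  have xN: "x \<in> N" using x(1) Nc by (simp add: compact_imp_closed frontier_def)
  then have xQ: "x \<in> closure \<Omega> - Q" using Ncl Q by blast
  then have "w x = w p" using x(2) pmax by (simp add: order_antisym)
  moreover have "x \<in> K"
  proof (rule ccontr)
    assume "x \<notin> K"
    then obtain q where q: "q \<in> Q" "x \<in> ball q (r q)" using xQ unfolding K_def by blast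
    moreover have "x \<noteq> q" using q(1) xQ by blast
    ultimately show False using r(2)[of q x] p(2)[OF zK] x(2) by (simp add: dist_commute)
  qed
  ultimately have "x \<in> interior N" using AN by (auto simp: A_def)
  then show False using x(1) by (simp add: frontier_def)
qed

subsection \<open>Behaviour at the singular points\<close>

lemma singular_harmonic_near:
  assumes "singular_harmonic_at F x0 h"
  shows "(h \<longlongrightarrow> h x0) (at x0)" and "h x0 \<noteq> \<infinity>"
    and "\<forall>\<^sub>F x in at x0. \<bar>h x\<bar> \<noteq> \<infinity> \<and> h x0 < h x"
proof -
  obtain U where U: "open U" "x0 \<in> U" "continuous_on U h" "\<forall>x\<in>U. h x \<noteq> \<infinity>"
    "F_harmonic F (U - {x0}) h" "\<forall>x\<in>U - {x0}. h x > h x0"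
    using assms unfolding singular_harmonic_at_def by blast
  show "(h \<longlongrightarrow> h x0) (at x0)"
    using U(1-3) by (simp add: continuous_on_eq_continuous_at continuous_at)
  show "h x0 \<noteq> \<infinity>" using U by blast
  have "\<forall>\<^sub>F x in at x0. x \<in> U - {x0}" using U(1,2) by (rule eventually_at_in_open)
  then show "\<forall>\<^sub>F x in at x0. \<bar>h x\<bar> \<noteq> \<infinity> \<and> h x0 < h x"
    by eventually_elim (use U(5,6) in \<open>auto simp: F_harmonic_def\<close>)
qed

text \<open>The two-sided bounds give \<open>(1 + \<epsilon>) * H1 - H2 \<le> \<epsilon> * h\<close>
  up to an additive constant, and \<open>h\<close> tends to \<open>-\<infinity>\<close>. The number
  \<open>b\<close> is the level of \<open>h\<close> at which this bound equals
  \<open>c\<close>.\<close>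

lemma polar_difference_small:
  assumes h: "singular_harmonic_at F x0 h" and polar: "polar_type x0 h" and "\<epsilon> > 0"
    and "asymp_equiv_at x0 h H1" "asymp_equiv_at x0 h H2"
  shows "\<forall>\<^sub>F x in at x0. (1 + \<epsilon>) * H1 x - H2 x < c"
proof -
  obtain C1 where C1: "\<forall>\<^sub>F x in at x0. h x - ereal C1 \<le> ereal (H1 x) \<and> ereal (H1 x) \<le> h x + ereal C1"
    using assms(4) polar unfolding asymp_equiv_at_def by auto
  obtain C2 where C2: "\<forall>\<^sub>F x in at x0. h x - ereal C2 \<le> ereal (H2 x) \<and> ereal (H2 x) \<le> h x + ereal C2"
    using assms(5) polar unfolding asymp_equiv_at_def by auto
  define b where "b = (c - (1 + \<epsilon>) * C1 - C2) / \<epsilon>"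
  have "(h \<longlongrightarrow> -\<infinity>) (at x0)" using singular_harmonic_near(1)[OF h] polar by (simp add: polar_type_def)
  then have "\<forall>\<^sub>F x in at x0. h x < ereal b" by (rule order_tendstoD) simp
  with C1 C2 singular_harmonic_near(3)[OF h] show ?thesis
  proof eventually_elim
    case (elim x)
    then obtain r where r: "h x = ereal r" by auto
    have "(1 + \<epsilon>) * H1 x \<le> (1 + \<epsilon>) * (r + C1)"
      using elim(1) r \<open>\<epsilon> > 0\<close> by (intro mult_left_mono) auto
    moreover have "r - C2 \<le> H2 x" using elim(2) r by simp
    moreover have "\<epsilon> * r < \<epsilon> * b" using elim(4) r \<open>\<epsilon> > 0\<close> by simp
    moreover have "\<epsilon> * b = c - (1 + \<epsilon>) * C1 - C2" using \<open>\<epsilon> > 0\<close> by (simp add: b_def)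
    ultimately show ?case by (simp add: algebra_simps)
  qed
qed

text \<open>Relative to the positive increment \<open>d\<close> of \<open>h\<close>, the increment
  of the difference tends to \<open>(1 + \<epsilon>) - 1 = \<epsilon>\<close>, which is positive;
  with factor 1 the limit would be 0 and would decide nothing. Continuity at the point is also drawn
  from the asymptotics, because \<open>d\<close> tends to 0: a solution is only required to be
  continuous away from the singular points.\<close>

lemma finite_type_difference:
  assumes h: "singular_harmonic_at F x0 h" and fin: "\<not> polar_type x0 h" and "\<epsilon> > 0"
    and "asymp_equiv_at x0 h H1" "asymp_equiv_at x0 h H2"
  shows "((\<lambda>x. (1 + \<epsilon>) * H1 x - H2 x) \<longlongrightarrow> (1 + \<epsilon>) * H1 x0 - H2 x0) (at x0)"
    and "\<forall>\<^sub>F x in at x0. (1 + \<epsilon>) * H1 x0 - H2 x0 < (1 + \<epsilon>) * H1 x - H2 x"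
proof -
  define d where "d x = real_of_ereal (h x) - real_of_ereal (h x0)" for x
  have r1: "((\<lambda>x. (H1 x - H1 x0) / d x) \<longlongrightarrow> 1) (at x0)" and r2: "((\<lambda>x. (H2 x - H2 x0) / d x) \<longlongrightarrow> 1) (at x0)"
    using assms(4,5) fin by (simp_all add: asymp_equiv_at_def d_def)
  have h0: "\<bar>h x0\<bar> \<noteq> \<infinity>" using singular_harmonic_near(2)[OF h] fin by (auto simp: polar_type_def)
  then have "((\<lambda>x. real_of_ereal (h x)) \<longlongrightarrow> real_of_ereal (h x0)) (at x0)"
    using singular_harmonic_near(1)[OF h] by (metis ereal_real lim_real_of_ereal)
  then have d0: "(d \<longlongrightarrow> 0) (at x0)" unfolding d_def by (auto intro: tendsto_eq_intros)
  have dpos: "\<forall>\<^sub>F x in at x0. d x > 0"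
    using singular_harmonic_near(3)[OF h]
  proof eventually_elim
    case (elim x)
    obtain r r0 where "h x = ereal r" "h x0 = ereal r0" using elim h0 by auto
    then show ?case using elim by (simp add: d_def)
  qed
  let ?q = "\<lambda>x. (1 + \<epsilon>) * ((H1 x - H1 x0) / d x) - (H2 x - H2 x0) / d x"
  have q: "(?q \<longlongrightarrow> (1 + \<epsilon>) * 1 - 1) (at x0)" by (intro tendsto_intros r1 r2)
  have eq: "\<forall>\<^sub>F x in at x0. (1 + \<epsilon>) * H1 x - H2 x = (1 + \<epsilon>) * H1 x0 - H2 x0 + ?q x * d x"
    using dpos by eventually_elim (simp add: field_simps)
  have "((\<lambda>x. (1 + \<epsilon>) * H1 x0 - H2 x0 + ?q x * d x) \<longlongrightarrow> (1 + \<epsilon>) * H1 x0 - H2 x0 + ((1 + \<epsilon>) * 1 - 1) * 0) (at x0)"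
    by (intro tendsto_add tendsto_const tendsto_mult q d0)
  then show "((\<lambda>x. (1 + \<epsilon>) * H1 x - H2 x) \<longlongrightarrow> (1 + \<epsilon>) * H1 x0 - H2 x0) (at x0)"
    using tendsto_cong[OF eq] by simp
  have "\<forall>\<^sub>F x in at x0. ?q x > 0" using q by (rule order_tendstoD) (use \<open>\<epsilon> > 0\<close> in simp)
  with dpos eq show "\<forall>\<^sub>F x in at x0. (1 + \<epsilon>) * H1 x0 - H2 x0 < (1 + \<epsilon>) * H1 x - H2 x"
    by eventually_elim simp
qed

section \<open>Comparison of two solutions and uniqueness\<close>

lemma DPPS_solution_le:
  fixes F :: "(real^'n^'n) set"
  assumes F: "cone_subequation F" and "open \<Omega>" and "bounded \<Omega>"
    and xs: "\<forall>j<k. xs j \<in> \<Omega>" and contphi: "continuous_on (frontier \<Omega>) \<phi>"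
    and hs: "\<forall>j<k. singular_harmonic_at F (xs j) (hs j)"
    and H1: "DPPS_solution F \<Omega> \<phi> k xs hs H1" and H2: "DPPS_solution F \<Omega> \<phi> k xs hs H2"
    and z: "z \<in> DPPS_domain \<Omega> k xs hs"
  shows "H1 z \<le> H2 z"
proof -
  define P where "P = xs ` {..<k}"
  define Q where "Q = {xs j | j. j < k \<and> polar_type (xs j) (hs j)}"
  have P: "finite P" "P \<subseteq> \<Omega>" and Q: "Q \<subseteq> P" using xs by (auto simp: P_def Q_def)
  have zQ: "z \<in> closure \<Omega> - Q" using z by (simp add: DPPS_domain_def Q_def)
  have c1: "continuous_on (closure \<Omega> - P) H1" and c2: "continuous_on (closure \<Omega> - P) H2"
    and s1: "F_subharmonic F (\<Omega> - P) (\<lambda>x. ereal (H1 x))"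
    and s2: "F_subharmonic (dual_subeq F) (\<Omega> - P) (\<lambda>x. ereal (- H2 x))"
    and b1: "\<forall>x\<in>frontier \<Omega>. H1 x = \<phi> x" and b2: "\<forall>x\<in>frontier \<Omega>. H2 x = \<phi> x"
    and a1: "\<forall>j<k. asymp_equiv_at (xs j) (hs j) H1" and a2: "\<forall>j<k. asymp_equiv_at (xs j) (hs j) H2"
    using H1 H2 unfolding DPPS_solution_def F_harmonic_def P_def by auto
  have "compact (frontier \<Omega>)" using \<open>bounded \<Omega>\<close> by (rule compact_frontier_bounded)
  then have "bounded (\<phi> ` frontier \<Omega>)" using contphi compact_continuous_image compact_imp_bounded by blast
  then obtain B where B: "\<And>x. x \<in> frontier \<Omega> \<Longrightarrow> \<bar>\<phi> x\<bar> \<le> B" unfolding bounded_iff by auto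
  \<comment> \<open>On the frontier the two solutions agree, so the difference there is
    \<open>\<epsilon> * \<phi>\<close>, at most \<open>\<epsilon> * B\<close>; the term
    \<open>- \<epsilon> * H1 z\<close> comes from removing the factor at \<open>z\<close>, which may
    itself be a singular point of finite type.\<close>
  have key: "H1 z - H2 z \<le> \<epsilon> * (B - H1 z)" if \<epsilon>: "\<epsilon> > 0" for \<epsilon>
  proof -
    have "\<exists>x\<in>frontier \<Omega>. (1 + \<epsilon>) * H1 z + - H2 z \<le> (1 + \<epsilon>) * H1 x + - H2 x"
    proof (rule maximum_principle_punctured[OF F \<open>open \<Omega>\<close> \<open>bounded \<Omega>\<close> P Q])
      show "quad_subharmonic F (\<Omega> - P) (\<lambda>x. (1 + \<epsilon>) * H1 x)"
        using \<epsilon> by (intro quad_subharmonic_scale[OF F] quad_subharmonic_if_F_subharmonic s1) simp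
      show "quad_subharmonic (dual_subeq F) (\<Omega> - P) (\<lambda>x. - H2 x)"
        by (rule quad_subharmonic_if_F_subharmonic[OF s2])
      show "\<forall>\<^sub>F x in at q. (1 + \<epsilon>) * H1 x + - H2 x < c" if qQ: "q \<in> Q" for q c
      proof -
        obtain j where j: "j < k" "q = xs j" "polar_type (xs j) (hs j)" using qQ by (auto simp: Q_def)
        then show ?thesis
          using polar_difference_small[of F "xs j" "hs j" \<epsilon> H1 H2 c] hs a1 a2 \<epsilon> by simp
      qed
      fix p assume "p \<in> P - Q"
      then obtain j where j: "j < k" "p = xs j" "\<not> polar_type (xs j) (hs j)" by (auto simp: P_def Q_def)
      show "((\<lambda>x. (1 + \<epsilon>) * H1 x + - H2 x) \<longlongrightarrow> (1 + \<epsilon>) * H1 p + - H2 p) (at p)"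
        and "\<forall>\<^sub>F x in at p. (1 + \<epsilon>) * H1 p + - H2 p < (1 + \<epsilon>) * H1 x + - H2 x"
        using finite_type_difference[of F "xs j" "hs j" \<epsilon> H1 H2] j hs a1 a2 \<epsilon> by simp_all
    qed (use zQ in \<open>auto intro!: continuous_intros c1 c2\<close>)
    then obtain x where x: "x \<in> frontier \<Omega>" "(1 + \<epsilon>) * H1 z - H2 z \<le> (1 + \<epsilon>) * H1 x - H2 x" by auto
    have "(1 + \<epsilon>) * H1 x - H2 x = \<epsilon> * \<phi> x" using b1 b2 x(1) by (simp add: algebra_simps)
    also have "\<dots> \<le> \<epsilon> * B" using B[OF x(1)] \<epsilon> by (intro mult_left_mono) auto
    finally show ?thesis using x(2) by (simp add: algebra_simps)
  qed
  have "((\<lambda>\<epsilon>. \<epsilon> * (B - H1 z)) \<longlongrightarrow> 0 * (B - H1 z)) (at_right 0)" by (intro tendsto_intros)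
  moreover have "\<forall>\<^sub>F \<epsilon> in at_right 0. H1 z - H2 z \<le> \<epsilon> * (B - H1 z)"
    using eventually_at_right_less[of "0::real"] by eventually_elim (rule key)
  ultimately have "H1 z - H2 z \<le> 0" by (metis mult_zero_left tendsto_lowerbound trivial_limit_at_right_real)
  then show ?thesis by simp
qed

theorem theorem1p3:
  fixes F :: "(real^'n^'n) set" and \<Omega> :: "(real^'n) set"
    and \<phi> :: "real^'n \<Rightarrow> real" and k :: nat
    and xs :: "nat \<Rightarrow> real^'n" and hs :: "nat \<Rightarrow> real^'n \<Rightarrow> ereal"
    and H1 H2 :: "real^'n \<Rightarrow> real"
  assumes "cone_subequation F"
    and "open \<Omega>" and "connected \<Omega>" and "bounded \<Omega>"
    and "\<forall>j<k. xs j \<in> \<Omega>" and "inj_on xs {..<k}"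
    and "continuous_on (frontier \<Omega>) \<phi>"
    and "\<forall>j<k. singular_harmonic_at F (xs j) (hs j)"
    and "DPPS_solution F \<Omega> \<phi> k xs hs H1"
    and "DPPS_solution F \<Omega> \<phi> k xs hs H2"
  shows "\<forall>x\<in>DPPS_domain \<Omega> k xs hs. H1 x = H2 x"
proof
  fix x assume x: "x \<in> DPPS_domain \<Omega> k xs hs"
  note le = DPPS_solution_le[OF assms(1,2,4,5,7,8) _ _ x]
  show "H1 x = H2 x" using le[OF assms(9,10)] le[OF assms(10,9)] by simp
qed

end
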